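(* Let $1\le p\le\infty$, $0\ne\lambda\in\mathbb{C}$, $0<\alpha\le1$, and let $T$ be an integral operator $Tf(x)=\int_{\mathbb{R}^d}K_T(x,y)f(y)\,dy$ whose kernel $K_T$ satisfies, for some positive constant $D$, $$\Big\|\sup_{y\in\mathbb{R}^d}|K_T(y,\cdot+y)|\,\Big\|_{\mathcal{W}_1}\le D\quad\text{and}\quad\Big\|\sup_{y\in\mathbb{R}^d}\omega_\delta(K_T)(y,\cdot+y)\Big\|_{\mathcal{W}_1}\le D\,\delta^\alpha\ \text{ for all }\delta\in(0,1).$$ If $\lambda I+T$ has a bounded inverse on $L^p$, then $(\lambda I+T)^{-1}=\lambda^{-1}I+\tilde T$ for some integral operator $\tilde T$ whose kernel $K_{\tilde T}$ satisfies, for some positive constant $\tilde D$, $$\Big\|\sup_{y\in\mathbb{R}^d}|K_{\tilde T}(y,\cdot+y)|\,\Big\|_{\mathcal{W}_1}\le\tilde D\quad\text{and}\quad\Big\|\sup_{y\in\mathbb{R}^d}\omega_\delta(K_{\tilde T})(y,\cdot+y)\Big\|_{\mathcal{W}_1}\le\tilde D\,\delta^\alpha\ \text{ for all }\delta\in(0,1).$$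
   Context: $L^p=L^p(\mathbb{R}^d)$ and $I$ is the identity operator on $L^p$. The Wiener amalgam norm on $\mathbb{R}^d$ is $\|\phi\|_{\mathcal{W}_1}=\sum_{k\in\mathbb{Z}^d}\sup_{x\in[0,1)^d}|\phi(k+x)|$. The modulus of continuity of a function $K$ on $\mathbb{R}^d\times\mathbb{R}^d$ is $\omega_\delta(K)(x,y)=\sup_{|(x',y')|\le\delta}|K(x+x',y+y')-K(x,y)|$, where $|\cdot|$ is the Euclidean norm on $\mathbb{R}^{2d}$. *)

theory Defs
  imports "HOL-Analysis.Analysis" "HOL-Probability.Essential_Supremum"
begin

text \<open>
  Elements of \<open>L\<^sup>p\<close> are represented by Borel functions rather than by equivalence classes, so
  equations between elements of \<open>L\<^sup>p\<close> are stated almost everywhere. The exponent \<open>p\<close> ranges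
  over \<^typ>\<open>ennreal\<close>, with \<open>p = \<infinity>\<close> allowed.
\<close>

definition Lp :: "ennreal \<Rightarrow> (real ^ 'n \<Rightarrow> complex) set" where
  "Lp p = {f \<in> borel_measurable lborel.
     if p = \<infinity> then esssup lborel (\<lambda>x. ennreal (cmod (f x))) < \<infinity>
     else (\<integral>\<^sup>+ x. ennreal (cmod (f x) powr enn2real p) \<partial>lborel) < \<infinity>}"

text \<open>Only meaningful on \<^const>\<open>Lp\<close>, where the values under \<^const>\<open>enn2real\<close> are finite.\<close>

definition Lp_norm :: "ennreal \<Rightarrow> (real ^ 'n \<Rightarrow> complex) \<Rightarrow> real" where
  "Lp_norm p f =
     (if p = \<infinity> then enn2real (esssup lborel (\<lambda>x. ennreal (cmod (f x))))
      else enn2real (\<integral>\<^sup>+ x. ennreal (cmod (f x) powr enn2real p) \<partial>lborel) powr (1 / enn2real p))"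

definition bounded_operator_on_Lp ::
    "ennreal \<Rightarrow> ((real ^ 'n \<Rightarrow> complex) \<Rightarrow> (real ^ 'n \<Rightarrow> complex)) \<Rightarrow> bool" where
  "bounded_operator_on_Lp p A \<longleftrightarrow>
     (\<forall>f\<in>Lp p. A f \<in> Lp p) \<and>
     (\<forall>f\<in>Lp p. \<forall>g\<in>Lp p. AE x in lborel. A (\<lambda>t. f t + g t) x = A f x + A g x) \<and>
     (\<forall>c. \<forall>f\<in>Lp p. AE x in lborel. A (\<lambda>t. c * f t) x = c * A f x) \<and>
     (\<exists>C. \<forall>f\<in>Lp p. Lp_norm p (A f) \<le> C * Lp_norm p f)"

text \<open>
  \<open>S\<close> is a bounded two-sided inverse of \<open>A\<close> on \<open>L\<^sup>p\<close>. By linearity and boundedness \<open>S\<close>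
  respects almost everywhere equality, and it is determined up to almost everywhere equality.
\<close>

definition bounded_inverse_on_Lp ::
    "ennreal \<Rightarrow> ((real ^ 'n \<Rightarrow> complex) \<Rightarrow> (real ^ 'n \<Rightarrow> complex))
      \<Rightarrow> ((real ^ 'n \<Rightarrow> complex) \<Rightarrow> (real ^ 'n \<Rightarrow> complex)) \<Rightarrow> bool" where
  "bounded_inverse_on_Lp p A S \<longleftrightarrow>
     bounded_operator_on_Lp p S \<and>
     (\<forall>f\<in>Lp p. (AE x in lborel. S (A f) x = f x) \<and> (AE x in lborel. A (S f) x = f x))"

text \<open>
  The Bochner integral is \<open>0\<close> for a non-integrable integrand. This default value plays no role for
  the kernels considered here: the amalgam bounds below make the kernel continuous (its modulus of
  continuity tends to \<open>0\<close> uniformly) and \<open>K (x, \<cdot>)\<close> both bounded and integrable, so the integral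
  converges absolutely for every \<open>x\<close> and every \<open>f\<close> in \<open>L\<^sup>p\<close>, \<open>1 \<le> p \<le> \<infinity>\<close>.
\<close>

definition integral_operator ::
    "((real ^ 'n) \<times> (real ^ 'n) \<Rightarrow> complex) \<Rightarrow> (real ^ 'n \<Rightarrow> complex) \<Rightarrow> (real ^ 'n \<Rightarrow> complex)" where
  "integral_operator K f x = (\<integral>y. K (x, y) * f y \<partial>lborel)"

text \<open>
  The norm is stated for \<open>[0, \<infinity>]\<close>-valued functions, as it is applied to suprema of absolute values;
  the sum over \<open>k\<close> in the integer lattice is an unordered sum in \<open>[0, \<infinity>]\<close>.
\<close>

definition wiener_amalgam_norm :: "(real ^ 'n \<Rightarrow> ennreal) \<Rightarrow> ennreal" where
  "wiener_amalgam_norm \<phi> =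
     (\<Sum>\<^sub>\<infinity>k\<in>(UNIV :: (int ^ 'n) set).
        SUP x\<in>{x. \<forall>i. 0 \<le> x $ i \<and> x $ i < 1}. \<phi> ((\<chi> i. real_of_int (k $ i)) + x))"

text \<open>The norm of a product type is the Euclidean one.\<close>

definition modulus_of_continuity ::
    "real \<Rightarrow> ((real ^ 'n) \<times> (real ^ 'n) \<Rightarrow> complex) \<Rightarrow> (real ^ 'n) \<times> (real ^ 'n) \<Rightarrow> ennreal" where
  "modulus_of_continuity \<delta> K z = (SUP h\<in>{h. norm h \<le> \<delta>}. ennreal (cmod (K (z + h) - K z)))"

definition amalgam_kernel_bounds ::
    "real \<Rightarrow> real \<Rightarrow> ((real ^ 'n) \<times> (real ^ 'n) \<Rightarrow> complex) \<Rightarrow> bool" where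
  "amalgam_kernel_bounds \<alpha> D K \<longleftrightarrow>
     wiener_amalgam_norm (\<lambda>x. SUP y. ennreal (cmod (K (y, x + y)))) \<le> ennreal D \<and>
     (\<forall>\<delta>. 0 < \<delta> \<and> \<delta> < 1 \<longrightarrow>
        wiener_amalgam_norm (\<lambda>x. SUP y. modulus_of_continuity \<delta> K (y, x + y))
          \<le> ennreal (D * \<delta> powr \<alpha>))"

end

theory Submission
  imports Defs "HOL-Real_Asymp.Real_Asymp"
begin

text \<open>
  All estimates are reduced to sequences on the integer lattice: a function is replaced by the
  sequence of its \<open>L\<^sup>p\<close> norms on unit cells, and the amalgam bound says that \<open>K\<close> acts on these
  sequences like convolution with some \<open>c \<in> \<ell>\<^sup>1\<close>.

  The inverse \<open>S\<close> inherits such a bound by an argument of Sjostrand's type. Let \<open>\<psi>\<close> be a cutoff of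
  width \<open>N\<close>, let \<open>A = \<lambda>I + T\<close> and \<open>f = S g\<close>. Then \<open>\<psi> f = S (\<psi> g + [T, \<psi>] f)\<close>, and the commutator
  \<open>[T, \<psi>]\<close> is small for large \<open>N\<close> because \<open>\<psi>\<close> is \<open>1/N\<close>-Lipschitz. This gives an inequality
  \<open>\<beta> \<le> \<gamma> + \<theta> * \<beta>\<close> for the norms \<open>\<beta> k\<close> of the translated cutoffs of \<open>f\<close>, with \<open>\<gamma>\<close> controlled by \<open>g\<close>
  and the \<open>\<ell>\<^sup>1\<close> norm of \<open>\<theta>\<close> at most \<open>1/2\<close>, and a Neumann series solves it.

  Finally \<open>S = \<lambda>\<^sup>-\<^sup>1 I - \<lambda>\<^sup>-\<^sup>2 T + \<lambda>\<^sup>-\<^sup>2 T S T\<close>. The kernel of \<open>T S T\<close> is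
  \<open>(x, y) \<mapsto> \<integral> K(x, z) (S K(\<cdot>, y))(z) dz\<close>, and both bounds for it are convolutions of the bounds for \<open>K\<close>
  with the one for \<open>S\<close>. That this is the kernel is checked by approximating \<open>T f\<close> by Riemann sums.
\<close>

section \<open>The \<open>L\<^sup>p\<close> norm of functions with values in \<open>[0, \<infinity>]\<close>\<close>

text \<open>The sequence \<open>c\<close> is only known to be summable, so the commutator is small
  without a rate: its bound contains \<open>a r * min 1 (supn r / N)\<close>, whose sum tends to 0
  by dominated convergence. The number of cutoffs that interact with a given one grows like N^d, but
  so does the mass F of one cutoff. After division by F the count is at most
  \<open>2 * 4 ^ CARD('n)\<close> for every N, so it does not spoil the smallness.

  T stands on both sides of S because S is given only modulo null sets and has no kernel a priori.
  The left T makes values at points meaningful, the right T feeds S with columns of K, and the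
  Hoelder modulus falls on one of these two outer factors. Of S itself only the cell bound is needed
  there.

  Fubini is not at hand for T S T f, since nothing is known about measurability of
  \<open>S (column y) z\<close> in (y, z). For p = \<infinity> neither density of nice functions nor
  weak continuity of S can replace it, and Riemann sums of T f need not converge in L^p. They do
  converge cell by cell, and the summable \<open>conv c W\<close> turns this into convergence of T S
  at each point.\<close>

definition epowr :: "ennreal \<Rightarrow> real \<Rightarrow> ennreal" where
  "epowr x r = (if x = top then top else ennreal (enn2real x powr r))"

lemma epowr_ennreal: "0 \<le> x \<Longrightarrow> epowr (ennreal x) r = ennreal (x powr r)"
  by (simp add: epowr_def)

lemma epowr_top [simp]: "epowr top r = top"
  by (simp add: epowr_def)

lemma epowr_0 [simp]: "epowr 0 r = 0"
  by (simp add: epowr_def)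

lemma epowr_eq_0_iff [simp]: "epowr x r = 0 \<longleftrightarrow> x = 0"
  by (cases x) (auto simp: epowr_def)

lemma epowr_eq_top_iff [simp]: "epowr x r = top \<longleftrightarrow> x = top"
  by (simp add: epowr_def)

lemma epowr_less_top_iff [simp]: "epowr x r < top \<longleftrightarrow> x < top"
  by (simp add: epowr_def top.not_eq_extremum)

lemma epowr_one [simp]: "epowr x 1 = x"
  by (cases x) (auto simp: epowr_def)

lemma epowr_mono: "0 \<le> r \<Longrightarrow> x \<le> y \<Longrightarrow> epowr x r \<le> epowr y r"
  by (cases x; cases y) (auto simp: epowr_def top_unique intro!: powr_mono2)

lemma epowr_mult: "0 < r \<Longrightarrow> epowr (x * y) r = epowr x r * epowr y r"
  by (cases x; cases y)
    (auto simp: epowr_def ennreal_mult_eq_top_iff enn2real_mult powr_mult ennreal_mult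
      ennreal_top_mult ennreal_mult_top)

lemma epowr_epowr: "epowr (epowr x r) s = epowr x (r * s)"
  by (cases x) (auto simp: epowr_def powr_powr)

lemma borel_measurable_epowr [measurable (raw)]:
  assumes [measurable]: "f \<in> borel_measurable M"
  shows "(\<lambda>x. epowr (f x) r) \<in> borel_measurable M"
  unfolding epowr_def by measurable

text \<open>The concave function u \<mapsto> u powr (1 / p) lies below its tangent at u = t powr p;
  here u = x powr p.\<close>

lemma epowr_tangent:
  fixes x t p :: real
  assumes "1 \<le> p" "0 < t" "0 \<le> x"
  shows "x \<le> x powr p * (t powr (1 - p) / p) + (1 - 1 / p) * t"
proof (cases "x = 0")
  case True
  then show ?thesis using assms by simp
next
  case False
  have "((x / t) powr p) powr (1 / p) * 1 powr (1 - 1 / p) \<le> 1 / p * ((x / t) powr p) + (1 - 1 / p) * 1"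
    by (rule Youngs_inequality_0) (use assms False in auto)
  then have "x / t \<le> 1 / p * ((x / t) powr p) + (1 - 1 / p)"
    using assms by (simp add: powr_powr)
  then have "x \<le> (1 / p * ((x / t) powr p) + (1 - 1 / p)) * t"
    using assms(2) by (simp add: pos_divide_le_eq)
  also have "\<dots> = x powr p * (t powr (1 - p) / p) + (1 - 1 / p) * t"
    using assms by (simp add: powr_divide powr_diff field_simps)
  finally show ?thesis .
qed

text \<open>Jensen's inequality for a measure of mass at most 1. With Y the right-hand side,
  integrating the tangent bound at t = Y powr (1 / p) gives at most t. The values Y = 0 and Y = top
  offer no tangent point and are treated apart.\<close>

lemma epowr_nn_integral_le:
  assumes [measurable]: "f \<in> borel_measurable M" and M: "emeasure M (space M) \<le> 1" and p: "1 \<le> p"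
  shows "epowr (\<integral>\<^sup>+x. f x \<partial>M) p \<le> (\<integral>\<^sup>+x. epowr (f x) p \<partial>M)"
proof -
  define Y where "Y = (\<integral>\<^sup>+x. epowr (f x) p \<partial>M)"
  consider "Y = top" | "Y = 0" | y where "Y = ennreal y" "0 < y"
    by (cases Y) (auto simp: less_le)
  then show ?thesis
  proof cases
    case 1
    then show ?thesis by (simp add: Y_def)
  next
    case 2
    then have "AE x in M. f x = 0"
      by (simp add: Y_def nn_integral_0_iff_AE)
    then have "(\<integral>\<^sup>+x. f x \<partial>M) = 0"
      by (simp add: nn_integral_0_iff_AE)
    then show ?thesis by simp
  next
    case (3 y)
    define t where "t = y powr (1 / p)"
    have t: "0 < t" using 3 by (simp add: t_def)
    have tp: "t powr p = y" using 3 p by (simp add: t_def powr_powr)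
    have ptw: "f x \<le> epowr (f x) p * ennreal (t powr (1 - p) / p) + ennreal ((1 - 1 / p) * t)" for x
    proof (cases "f x")
      case (real r)
      then show ?thesis
        using epowr_tangent[OF p t, of r] p t
        by (simp add: epowr_ennreal flip: ennreal_mult ennreal_plus)
    next
      case top
      then show ?thesis using p t by (simp add: ennreal_top_mult)
    qed
    have "(\<integral>\<^sup>+x. f x \<partial>M)
        \<le> (\<integral>\<^sup>+x. epowr (f x) p * ennreal (t powr (1 - p) / p) + ennreal ((1 - 1 / p) * t) \<partial>M)"
      by (rule nn_integral_mono) (rule ptw)
    also have "\<dots> = Y * ennreal (t powr (1 - p) / p) + ennreal ((1 - 1 / p) * t) * emeasure M (space M)"
      by (subst nn_integral_add) (auto simp: nn_integral_multc Y_def)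
    also have "\<dots> \<le> Y * ennreal (t powr (1 - p) / p) + ennreal ((1 - 1 / p) * t) * 1"
      by (intro add_mono mult_mono M) auto
    also have "\<dots> = ennreal (y * (t powr (1 - p) / p) + (1 - 1 / p) * t)"
      using 3 p t by (simp flip: ennreal_mult ennreal_plus)
    also have "y * (t powr (1 - p) / p) + (1 - 1 / p) * t = t"
      using t p by (simp add: tp[symmetric] powr_diff field_simps)
    finally have "epowr (\<integral>\<^sup>+x. f x \<partial>M) p \<le> epowr (ennreal t) p"
      using p by (intro epowr_mono) auto
    also have "\<dots> = Y"
      using t 3 tp by (simp add: epowr_ennreal)
    finally show ?thesis by (simp add: Y_def)
  qed
qed

text \<open>
  Unlike \<^const>\<open>Lp_norm\<close>, this takes the value \<open>\<infinity>\<close> off \<^const>\<open>Lp\<close>. The counting measure gives the \<open>\<ell>\<^sup>p\<close> norm.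
\<close>

definition Np :: "ennreal \<Rightarrow> 'a measure \<Rightarrow> ('a \<Rightarrow> ennreal) \<Rightarrow> ennreal" where
  "Np p M f = (if p = \<infinity> then esssup M f
     else epowr (\<integral>\<^sup>+x. epowr (f x) (enn2real p) \<partial>M) (1 / enn2real p))"

section \<open>Norms in [0, \<infinity>] and Minkowski's inequality\<close>

lemma one_le_enn2real: "1 \<le> p \<Longrightarrow> p \<noteq> \<infinity> \<Longrightarrow> 1 \<le> enn2real p"
  by (cases p) auto

lemma epowr_Np:
  assumes "1 \<le> p" "p \<noteq> \<infinity>"
  shows "epowr (Np p M f) (enn2real p) = (\<integral>\<^sup>+x. epowr (f x) (enn2real p) \<partial>M)"
  using assms one_le_enn2real[OF assms] by (simp add: Np_def epowr_epowr)

lemma Np_leI: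
  assumes "1 \<le> p" "p \<noteq> \<infinity>" "(\<integral>\<^sup>+x. epowr (f x) (enn2real p) \<partial>M) \<le> epowr c (enn2real p)"
  shows "Np p M f \<le> c"
proof -
  have "Np p M f \<le> epowr (epowr c (enn2real p)) (1 / enn2real p)"
    using assms by (simp add: Np_def epowr_mono)
  also have "\<dots> = c"
    using one_le_enn2real[OF assms(1,2)] by (simp add: epowr_epowr)
  finally show ?thesis .
qed

lemma Np_mono_AE:
  assumes "f \<in> borel_measurable M" "AE x in M. f x \<le> g x" "1 \<le> p"
  shows "Np p M f \<le> Np p M g"
proof (cases "p = \<infinity>")
  case True
  then show ?thesis using assms by (simp add: Np_def esssup_AE_mono)
next
  case False
  have "AE x in M. epowr (f x) (enn2real p) \<le> epowr (g x) (enn2real p)"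
    using assms(2) by eventually_elim (simp add: epowr_mono)
  then show ?thesis
    using False by (simp add: Np_def epowr_mono nn_integral_mono_AE)
qed

lemma Np_mono:
  assumes "f \<in> borel_measurable M" "\<And>x. f x \<le> g x" "1 \<le> p"
  shows "Np p M f \<le> Np p M g"
  using assms by (intro Np_mono_AE) auto

lemma Np_cong_AE:
  assumes "f \<in> borel_measurable M" "g \<in> borel_measurable M" "AE x in M. f x = g x" "1 \<le> p"
  shows "Np p M f = Np p M g"
  using assms by (intro antisym Np_mono_AE) auto

lemma Np_eq_0D:
  assumes "f \<in> borel_measurable M" "1 \<le> p" "Np p M f = 0"
  shows "AE x in M. f x = 0"
proof (cases "p = \<infinity>")
  case True
  then show ?thesis using esssup_AE[where M = M and f = f] assms by (simp add: Np_def)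
next
  case False
  then show ?thesis using assms by (simp add: Np_def nn_integral_0_iff_AE)
qed

lemma Np_cmult_le:
  assumes [measurable]: "f \<in> borel_measurable M" and "1 \<le> p"
  shows "Np p M (\<lambda>x. c * f x) \<le> c * Np p M f"
proof (cases "p = \<infinity>")
  case True
  have "AE x in M. c * f x \<le> c * esssup M f"
    using esssup_AE[where M = M and f = f] by eventually_elim (simp add: mult_left_mono)
  then show ?thesis using True by (auto simp: Np_def intro!: esssup_I)
next
  case False
  have pos: "0 < enn2real p" using one_le_enn2real[OF assms(2) False] by simp
  show ?thesis
    by (rule Np_leI)
      (use assms False pos in \<open>simp_all add: epowr_mult nn_integral_cmult epowr_Np\<close>)
qed

text \<open>The inequality missing in \<open>Np_cmult_le\<close> is that lemma for the factor 1 / c,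
  which undoes c when c is neither 0 nor top.\<close>

lemma Np_cmult:
  assumes [measurable]: "f \<in> borel_measurable M" and p: "1 \<le> p" and c: "c < top"
  shows "Np p M (\<lambda>x. c * f x) = c * Np p M f"
proof (rule antisym)
  show "Np p M (\<lambda>x. c * f x) \<le> c * Np p M f"
    by (rule Np_cmult_le) (simp_all add: p)
  show "c * Np p M f \<le> Np p M (\<lambda>x. c * f x)"
  proof (cases "c = 0")
    case False
    have inv: "1 / c * (c * y) = y" "c * (1 / c * y) = y" for y
    proof -
      have one: "1 / c * c = 1" using c False by (simp add: ennreal_divide_times)
      moreover have "c * (1 / c) = 1" using one by (subst mult.commute)
      ultimately show "1 / c * (c * y) = y" "c * (1 / c * y) = y"
        by (simp_all only: mult.assoc[symmetric] mult_1_left)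
    qed
    have "c * Np p M f = c * Np p M (\<lambda>x. 1 / c * (c * f x))"
      by (simp only: inv)
    also have "\<dots> \<le> c * (1 / c * Np p M (\<lambda>x. c * f x))"
      by (intro mult_left_mono Np_cmult_le p) auto
    finally show ?thesis by (simp only: inv)
  qed simp
qed

text \<open>Minkowski's inequality for countably many terms. With M the counting measure it also
  yields Young's inequality for convolutions and the embedding of l^1 into l^p.\<close>

lemma Np_sum_le:
  fixes c :: "'g::countable \<Rightarrow> 'a \<Rightarrow> ennreal"
  assumes [measurable]: "\<And>n. c n \<in> borel_measurable M" and p: "1 \<le> p"
  shows "Np p M (\<lambda>x. \<integral>\<^sup>+n. c n x \<partial>count_space UNIV) \<le> (\<integral>\<^sup>+n. Np p M (c n) \<partial>count_space UNIV)"
proof -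
  define Q where "Q = (\<integral>\<^sup>+n. Np p M (c n) \<partial>count_space UNIV)"
  have meas [measurable]: "(\<lambda>x. \<integral>\<^sup>+n. c n x \<partial>count_space UNIV) \<in> borel_measurable M"
  proof -
    interpret sigma_finite_measure "count_space (UNIV :: 'g set)"
      by (rule sigma_finite_measure_count_space)
    have "(\<lambda>z. c (snd z) (fst z)) \<in> borel_measurable (M \<Otimes>\<^sub>M count_space UNIV)"
    proof (rule measurable_compose_countable'[where g = snd and I = UNIV])
      show "(\<lambda>z. c i (fst z)) \<in> borel_measurable (M \<Otimes>\<^sub>M count_space UNIV)" for i
        by measurable
    qed auto
    then have "(\<lambda>x. \<integral>\<^sup>+n. (\<lambda>z. c (snd z) (fst z)) (x, n) \<partial>count_space UNIV) \<in> borel_measurable M"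
      by (intro borel_measurable_nn_integral_fst)
    then show ?thesis by simp
  qed
  show ?thesis
  proof (cases "p = \<infinity>")
    case True
    have "AE x in M. \<forall>n. c n x \<le> esssup M (c n)"
      by (subst AE_all_countable) (auto intro: esssup_AE)
    then have "AE x in M. (\<integral>\<^sup>+n. c n x \<partial>count_space UNIV) \<le> (\<integral>\<^sup>+n. esssup M (c n) \<partial>count_space UNIV)"
      by eventually_elim (auto intro: nn_integral_mono)
    then show ?thesis using True by (auto simp: Np_def intro!: esssup_I)
  next
    case False
    define r where "r = enn2real p"
    have r: "1 \<le> r" using one_le_enn2real[OF p False] by (simp add: r_def)
    consider "Q = top" | "Q = 0" | "Q \<noteq> 0" "Q \<noteq> top" by blast
    then show ?thesis
    proof cases
      case 1
      then show ?thesis by (simp add: Q_def)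
    next
      case 2
      then have "\<forall>n. Np p M (c n) = 0"
        by (simp add: Q_def nn_integral_0_iff_AE AE_count_space)
      then have "AE x in M. \<forall>n. c n x = 0"
        by (subst AE_all_countable) (auto intro!: Np_eq_0D p)
      then have "AE x in M. (\<integral>\<^sup>+n. c n x \<partial>count_space UNIV) = 0"
        by eventually_elim simp
      then have "Np p M (\<lambda>x. \<integral>\<^sup>+n. c n x \<partial>count_space UNIV) = Np p M (\<lambda>x. 0)"
        by (intro Np_cong_AE p) auto
      also have "\<dots> = 0" using False by (simp add: Np_def)
      finally show ?thesis by simp
    next
      case 3
      define N where "N n = Np p M (c n)" for n
      \<comment> \<open>Jensen for the weights \<open>N n / Q\<close>, as \<open>c n = (N n / Q) * (c n * (Q / N n))\<close>.\<close>
      define \<mu> where "\<mu> = density (count_space UNIV) (\<lambda>n. N n / Q)"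
      have m1: "emeasure \<mu> (space \<mu>) \<le> 1"
      proof -
        have "emeasure \<mu> (space \<mu>) = (\<integral>\<^sup>+n. N n / Q \<partial>count_space UNIV)"
          by (simp add: \<mu>_def emeasure_density)
        also have "\<dots> = Q / Q" by (simp add: nn_integral_divide Q_def N_def)
        also have "\<dots> \<le> 1" using 3 by (simp add: less_top)
        finally show ?thesis .
      qed
      have Nfin: "N n \<noteq> top" for n
      proof -
        have "N n \<le> Q"
          unfolding Q_def N_def by (rule nn_integral_ge_point) simp
        then show ?thesis using 3 neq_top_trans by blast
      qed
      have cancel: "N n / Q * (y * (Q / N n)) = y" if "N n \<noteq> 0" for n y
      proof -
        have "N n / Q * (Q / N n) = 1"
          using that Nfin[of n] 3
          by (simp add: ennreal_times_divide ennreal_divide_times less_top)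
        then show ?thesis by (metis mult.assoc mult.commute mult.right_neutral)
      qed
      \<comment> \<open>A term of norm 0 cannot be renormalised by \<open>Q / N n\<close>; it drops
        out because it vanishes almost everywhere.\<close>
      have "AE x in M. \<forall>n. N n = 0 \<longrightarrow> c n x = 0"
        by (subst AE_all_countable) (auto simp: N_def dest: Np_eq_0D[rotated -1] intro!: Np_eq_0D p)
      then have ae: "AE x in M. epowr (\<integral>\<^sup>+n. c n x \<partial>count_space UNIV) r
          \<le> (\<integral>\<^sup>+n. N n / Q * epowr (c n x * (Q / N n)) r \<partial>count_space UNIV)"
      proof eventually_elim
        case (elim x)
        have "(\<integral>\<^sup>+n. c n x \<partial>count_space UNIV) = (\<integral>\<^sup>+n. N n / Q * (c n x * (Q / N n)) \<partial>count_space UNIV)"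
        proof (rule nn_integral_cong)
          fix n show "c n x = N n / Q * (c n x * (Q / N n))"
            using cancel[of n "c n x"] elim by (cases "N n = 0") auto
        qed
        also have "\<dots> = (\<integral>\<^sup>+n. c n x * (Q / N n) \<partial>\<mu>)"
          by (simp add: \<mu>_def nn_integral_density)
        finally have "epowr (\<integral>\<^sup>+n. c n x \<partial>count_space UNIV) r = epowr (\<integral>\<^sup>+n. c n x * (Q / N n) \<partial>\<mu>) r"
          by simp
        also have "\<dots> \<le> (\<integral>\<^sup>+n. epowr (c n x * (Q / N n)) r \<partial>\<mu>)"
          by (rule epowr_nn_integral_le) (auto simp: m1 r, simp add: \<mu>_def)
        also have "\<dots> = (\<integral>\<^sup>+n. N n / Q * epowr (c n x * (Q / N n)) r \<partial>count_space UNIV)"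
          by (simp add: \<mu>_def nn_integral_density)
        finally show ?case .
      qed
      have "(\<integral>\<^sup>+x. epowr (\<integral>\<^sup>+n. c n x \<partial>count_space UNIV) r \<partial>M)
          \<le> (\<integral>\<^sup>+x. \<integral>\<^sup>+n. N n / Q * epowr (c n x * (Q / N n)) r \<partial>count_space UNIV \<partial>M)"
        by (rule nn_integral_mono_AE[OF ae])
      also have "\<dots> = (\<integral>\<^sup>+n. \<integral>\<^sup>+x. N n / Q * epowr (c n x * (Q / N n)) r \<partial>M \<partial>count_space UNIV)"
        by (rule nn_integral_count_space_nn_integral) auto
      also have "\<dots> = (\<integral>\<^sup>+n. N n / Q * epowr (N n * (Q / N n)) r \<partial>count_space UNIV)"
        using r p False
        by (simp add: epowr_mult nn_integral_cmult nn_integral_multc N_def epowr_Np r_def)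
      also have "\<dots> \<le> (\<integral>\<^sup>+n. N n / Q * epowr Q r \<partial>count_space UNIV)"
      proof (intro nn_integral_mono mult_left_mono epowr_mono)
        fix n show "N n * (Q / N n) \<le> Q"
          using Nfin[of n] by (cases "N n = 0")
            (auto simp: ennreal_times_divide mult.commute[of _ Q] ennreal_mult_divide_eq)
      qed (use r in auto)
      also have "\<dots> = (Q / Q) * epowr Q r"
        by (simp add: nn_integral_multc nn_integral_divide N_def Q_def)
      also have "\<dots> = epowr Q r" using 3 by (simp add: less_top)
      finally show ?thesis
        using p False by (intro Np_leI) (simp_all add: Q_def r_def)
    qed
  qed
qed

lemma Np_add_le:
  assumes [measurable]: "f \<in> borel_measurable M" "g \<in> borel_measurable M" and p: "1 \<le> p"
  shows "Np p M (\<lambda>x. f x + g x) \<le> Np p M f + Np p M g"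
  using Np_sum_le[of "\<lambda>b. if b then f else g" M p] p
  by (simp add: nn_integral_count_space_finite UNIV_bool add.commute)

section \<open>Convolution of sequences and Neumann series\<close>

text \<open>As integrals over the counting measure, sums admit Tonelli, monotone and dominated
  convergence, and \<open>Np\<close> covers sequences too.\<close>

abbreviation tsum :: "('g \<Rightarrow> ennreal) \<Rightarrow> ennreal" where
  "tsum a \<equiv> nn_integral (count_space UNIV) a"

abbreviation seq_norm :: "ennreal \<Rightarrow> ('g \<Rightarrow> ennreal) \<Rightarrow> ennreal" where
  "seq_norm p u \<equiv> Np p (count_space UNIV) u"

definition conv :: "('g::ab_group_add \<Rightarrow> ennreal) \<Rightarrow> ('g \<Rightarrow> ennreal) \<Rightarrow> 'g \<Rightarrow> ennreal" where
  "conv a b i = (\<integral>\<^sup>+j. a (i - j) * b j \<partial>count_space UNIV)"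

lemma tsum_shift:
  fixes a :: "'g::ab_group_add \<Rightarrow> ennreal"
  shows "tsum (\<lambda>i. a (i - j)) = tsum a"
  by (rule nn_integral_bij_count_space) (auto intro!: bij_betwI[where g = "\<lambda>i. i + j"])

lemma tsum_reflect:
  fixes a :: "'g::ab_group_add \<Rightarrow> ennreal"
  shows "tsum (\<lambda>i. a (j - i)) = tsum a"
  by (rule nn_integral_bij_count_space) (auto intro!: bij_betwI[where g = "\<lambda>i. j - i"])

lemma tsum_swap:
  fixes f :: "'g::countable \<Rightarrow> 'h \<Rightarrow> ennreal"
  shows "tsum (\<lambda>j. tsum (\<lambda>i. f i j)) = tsum (\<lambda>i. tsum (\<lambda>j. f i j))"
  by (rule nn_integral_count_space_nn_integral) auto

lemma le_tsum: "a i \<le> tsum a"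
  by (rule nn_integral_ge_point) simp

lemma conv_commute: "conv a b i = conv b a i"
proof -
  have "conv a b i = tsum (\<lambda>j. a (i - (i - j)) * b (i - j))"
    unfolding conv_def by (rule tsum_reflect[symmetric])
  then show ?thesis by (simp add: conv_def mult.commute)
qed

lemma conv_mono: "(\<And>i. a i \<le> a' i) \<Longrightarrow> (\<And>i. b i \<le> b' i) \<Longrightarrow> conv a b i \<le> conv a' b' i"
  unfolding conv_def by (intro nn_integral_mono mult_mono) auto

lemma tsum_conv:
  fixes a b :: "'g::{ab_group_add,countable} \<Rightarrow> ennreal"
  shows "tsum (conv a b) = tsum a * tsum b"
proof -
  have "tsum (conv a b) = tsum (\<lambda>j. tsum (\<lambda>i. a (i - j) * b j))"
    unfolding conv_def by (rule tsum_swap)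
  also have "\<dots> = tsum (\<lambda>j. tsum a * b j)"
    by (simp add: nn_integral_multc tsum_shift)
  finally show ?thesis by (simp add: nn_integral_cmult)
qed

lemma conv_assoc:
  fixes a b c :: "'g::{ab_group_add,countable} \<Rightarrow> ennreal"
  shows "conv (conv a b) c i = conv a (conv b c) i"
proof -
  have "conv (conv a b) c i = tsum (\<lambda>k. tsum (\<lambda>j. a (i - k - j) * b j * c k))"
    by (simp add: conv_def nn_integral_multc)
  also have "\<dots> = tsum (\<lambda>k. tsum (\<lambda>j. a (i - k - (j - k)) * b (j - k) * c k))"
    by (rule nn_integral_cong, subst tsum_shift[symmetric]) (rule refl)
  also have "\<dots> = tsum (\<lambda>j. tsum (\<lambda>k. a (i - j) * (b (j - k) * c k)))"
    by (subst tsum_swap) (simp add: mult.assoc)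
  also have "\<dots> = conv a (conv b c) i"
    by (simp add: conv_def nn_integral_cmult)
  finally show ?thesis .
qed

lemma conv_le_bound: "(\<And>j. b j \<le> B) \<Longrightarrow> conv a b i \<le> tsum a * B"
proof -
  assume b: "\<And>j. b j \<le> B"
  have "conv a b i \<le> tsum (\<lambda>j. a (i - j) * B)"
    unfolding conv_def by (intro nn_integral_mono mult_left_mono b) simp
  also have "\<dots> = tsum a * B" by (simp add: nn_integral_multc tsum_reflect)
  finally show ?thesis .
qed

lemma conv_add_right: "conv a (\<lambda>j. b j + c j) i = conv a b i + conv a c i"
  by (simp add: conv_def distrib_left nn_integral_add)

lemma conv_cmult_right: "conv a (\<lambda>j. C * b j) i = C * conv a b i"
  by (simp add: conv_def nn_integral_cmult[symmetric] mult_ac)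

lemma conv_cmult_left: "conv (\<lambda>j. C * a j) b i = C * conv a b i"
  by (simp add: conv_def nn_integral_cmult[symmetric] mult_ac)

lemma conv_indicator_0: "conv (indicator {0}) b i = b i"
proof -
  have "conv (indicator {0}) b i = tsum (\<lambda>j. b j * indicator {i} j)"
    unfolding conv_def by (intro nn_integral_cong) (auto split: split_indicator)
  then show ?thesis by simp
qed

lemma seq_norm_shift:
  fixes u :: "'g::{ab_group_add,countable} \<Rightarrow> ennreal"
  shows "seq_norm p (\<lambda>i. u (i - r)) = seq_norm p u"
proof -
  have "esssup (count_space UNIV) (\<lambda>i. u (i - r)) = esssup (count_space UNIV) u"
  proof (rule antisym; rule esssup_I)
    show "AE x in count_space UNIV. u (x - r) \<le> esssup (count_space UNIV) u"
      using esssup_AE[where M = "count_space UNIV" and f = u] by (simp add: AE_count_space)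
    show "AE x in count_space UNIV. u x \<le> esssup (count_space UNIV) (\<lambda>i. u (i - r))"
      using esssup_AE[where M = "count_space UNIV" and f = "\<lambda>i. u (i - r)"]
      by (simp add: AE_count_space) (metis add_diff_cancel_right')
  qed auto
  then show ?thesis
    using tsum_shift[of "\<lambda>i. epowr (u i) (enn2real p)" r] by (simp add: Np_def)
qed

lemma le_seq_norm:
  assumes "1 \<le> p" shows "u i \<le> seq_norm p u"
proof (cases "p = \<infinity>")
  case True
  then show ?thesis
    using esssup_AE[where M = "count_space UNIV" and f = u] by (simp add: Np_def AE_count_space)
next
  case False
  have "u i = epowr (epowr (u i) (enn2real p)) (1 / enn2real p)"
    using one_le_enn2real[OF assms False] by (simp add: epowr_epowr)
  also have "\<dots> \<le> seq_norm p u"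
    using False by (auto simp: Np_def intro!: epowr_mono le_tsum[of "\<lambda>i. epowr (u i) (enn2real p)"])
  finally show ?thesis .
qed

lemma seq_norm_indicator:
  assumes "1 \<le> p" shows "seq_norm p (\<lambda>i. c * indicator {j} i) = c"
proof (rule antisym)
  show "seq_norm p (\<lambda>i. c * indicator {j} i) \<le> c"
  proof (cases "p = \<infinity>")
    case True
    then show ?thesis
      by (auto simp: Np_def AE_count_space intro!: esssup_I split: split_indicator)
  next
    case False
    have "(\<lambda>i. epowr (c * indicator {j} i) (enn2real p)) = (\<lambda>i. epowr c (enn2real p) * indicator {j} i)"
      by (auto split: split_indicator)
    then show ?thesis using assms False by (intro Np_leI) simp_all
  qed
  show "c \<le> seq_norm p (\<lambda>i. c * indicator {j} i)"
    using le_seq_norm[OF assms, of "\<lambda>i. c * indicator {j} i" j] by simp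
qed

lemma seq_norm_le_tsum:
  fixes u :: "'g::countable \<Rightarrow> ennreal"
  assumes "1 \<le> p" shows "seq_norm p u \<le> tsum u"
proof -
  have "u i = tsum (\<lambda>j. u j * indicator {j} i)" for i
  proof -
    have "tsum (\<lambda>j. u j * indicator {j} i) = tsum (\<lambda>j. u j * indicator {i} j)"
      by (intro nn_integral_cong) (auto split: split_indicator)
    then show ?thesis by simp
  qed
  then have "seq_norm p u = seq_norm p (\<lambda>i. tsum (\<lambda>j. u j * indicator {j} i))"
    by (intro arg_cong[where f = "seq_norm p"] ext)
  also have "\<dots> \<le> tsum (\<lambda>j. seq_norm p (\<lambda>i. u j * indicator {j} i))"
    by (rule Np_sum_le) (auto simp: assms)
  also have "\<dots> = tsum u" by (simp add: seq_norm_indicator assms)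
  finally show ?thesis .
qed

text \<open>Young's inequality: after commuting, the convolution is a sum of translates of
  \<open>u\<close> with weights \<open>a r\<close>, and translation preserves the norm.\<close>

lemma seq_norm_conv_le:
  fixes a u :: "'g::{ab_group_add,countable} \<Rightarrow> ennreal"
  assumes "1 \<le> p"
  shows "seq_norm p (conv a u) \<le> tsum a * seq_norm p u"
proof -
  have "seq_norm p (conv a u) = seq_norm p (conv u a)"
    by (intro arg_cong[where f = "seq_norm p"] ext conv_commute)
  also have "\<dots> \<le> tsum (\<lambda>r. seq_norm p (\<lambda>i. a r * u (i - r)))"
    unfolding conv_def by (subst mult.commute) (rule Np_sum_le, auto simp: assms)
  also have "\<dots> \<le> tsum (\<lambda>r. a r * seq_norm p u)"
  proof (rule nn_integral_mono)
    fix r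
    have "seq_norm p (\<lambda>i. a r * u (i - r)) \<le> a r * seq_norm p (\<lambda>i. u (i - r))"
      by (rule Np_cmult_le) (auto simp: assms)
    then show "seq_norm p (\<lambda>i. a r * u (i - r)) \<le> a r * seq_norm p u"
      by (simp add: seq_norm_shift)
  qed
  also have "\<dots> = tsum a * seq_norm p u" by (simp add: nn_integral_multc)
  finally show ?thesis .
qed

section \<open>Neumann series for convolution\<close>

primrec conv_power :: "('g::ab_group_add \<Rightarrow> ennreal) \<Rightarrow> nat \<Rightarrow> 'g \<Rightarrow> ennreal" where
  "conv_power a 0 = indicator {0}"
| "conv_power a (Suc n) = conv (conv_power a n) a"

lemma tsum_conv_power:
  fixes a :: "'g::{ab_group_add,countable} \<Rightarrow> ennreal"
  shows "tsum (conv_power a n) = tsum a ^ n"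
  by (induction n) (simp_all add: tsum_conv mult.commute)

lemma half_power_ennreal: "(1 / 2 :: ennreal) ^ n = ennreal ((1 / 2) ^ n)"
proof -
  have "(1 / 2 :: ennreal) = ennreal (1 / 2)" by (simp add: divide_ennreal_def)
  then show ?thesis by (simp only: ennreal_power[symmetric])
qed

text \<open>Iterating the inequality m times leaves the remainder
  \<open>conv (conv_power \<theta> m) \<beta>\<close>, which is at most B / 2^m. The finite a priori
  bound B is essential: for \<theta> \<noteq> 0 the constant top satisfies the inequality as
  well.\<close>

lemma neumann_le:
  fixes \<theta> \<beta> \<gamma> :: "'g::{ab_group_add,countable} \<Rightarrow> ennreal"
  assumes \<theta>: "tsum \<theta> \<le> 1 / 2" and \<beta>: "\<And>k. \<beta> k \<le> B" "B < top"
    and le: "\<And>k. \<beta> k \<le> \<gamma> k + conv \<theta> \<beta> k"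
  shows "\<beta> k \<le> conv (\<lambda>i. \<Sum>n. conv_power \<theta> n i) \<gamma> k"
proof -
  have iter: "\<beta> k \<le> (\<Sum>n<m. conv (conv_power \<theta> n) \<gamma> k) + conv (conv_power \<theta> m) \<beta> k" for m k
  proof (induction m)
    case 0
    then show ?case by (simp add: conv_indicator_0)
  next
    case (Suc m)
    have "conv (conv_power \<theta> m) \<beta> k \<le> conv (conv_power \<theta> m) (\<lambda>k. \<gamma> k + conv \<theta> \<beta> k) k"
      by (rule conv_mono) (auto intro: le)
    also have "\<dots> = conv (conv_power \<theta> m) \<gamma> k + conv (conv_power \<theta> (Suc m)) \<beta> k"
      by (simp add: conv_add_right conv_assoc)
    finally have step: "conv (conv_power \<theta> m) \<beta> k
        \<le> conv (conv_power \<theta> m) \<gamma> k + conv (conv_power \<theta> (Suc m)) \<beta> k" .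
    show ?case
      using order_trans[OF Suc.IH add_left_mono[OF step]] by (simp add: add.assoc)
  qed
  have sum_le: "(\<Sum>n<m. conv (conv_power \<theta> n) \<gamma> k) \<le> conv (\<lambda>i. \<Sum>n. conv_power \<theta> n i) \<gamma> k" for m
  proof -
    have "(\<Sum>n<m. conv (conv_power \<theta> n) \<gamma> k) = conv (\<lambda>i. \<Sum>n<m. conv_power \<theta> n i) \<gamma> k"
      by (simp add: conv_def sum_distrib_right nn_integral_sum)
    also have "\<dots> \<le> conv (\<lambda>i. \<Sum>n. conv_power \<theta> n i) \<gamma> k"
      by (intro conv_mono sum_le_suminf) auto
    finally show ?thesis .
  qed
  have rem: "conv (conv_power \<theta> m) \<beta> k \<le> (1 / 2) ^ m * B" for m
  proof -
    have "conv (conv_power \<theta> m) \<beta> k \<le> tsum \<theta> ^ m * B"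
      using conv_le_bound[of \<beta> B "conv_power \<theta> m"] \<beta>(1) by (simp add: tsum_conv_power)
    also have "\<dots> \<le> (1 / 2) ^ m * B"
      by (intro mult_right_mono power_mono \<theta>) auto
    finally show ?thesis .
  qed
  have lim: "(\<lambda>m. (1 / 2) ^ m * B) \<longlonglongrightarrow> 0"
  proof -
    obtain b where b: "B = ennreal b" "0 \<le> b" using \<beta>(2) by (cases B) auto
    have "(1 / 2 :: ennreal) ^ m * B = ennreal ((1 / 2) ^ m * b)" for m
      using b by (simp add: half_power_ennreal ennreal_mult)
    moreover have "(\<lambda>m. (1 / 2) ^ m * b) \<longlonglongrightarrow> 0 * b"
      by (intro tendsto_mult tendsto_const LIMSEQ_power_zero) simp
    ultimately show ?thesis by (simp add: ennreal_tendsto_0_iff b)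
  qed
  let ?R = "conv (\<lambda>i. \<Sum>n. conv_power \<theta> n i) \<gamma> k"
  have "(\<lambda>m. ?R + (1 / 2) ^ m * B) \<longlonglongrightarrow> ?R + 0"
    by (intro tendsto_add tendsto_const lim)
  moreover have "\<beta> k \<le> ?R + (1 / 2) ^ m * B" for m
    by (rule order_trans[OF iter[of k m] add_mono[OF sum_le rem]])
  ultimately show ?thesis
    using LIMSEQ_le_const[of "\<lambda>m. ?R + (1 / 2) ^ m * B" "?R + 0" "\<beta> k"] by simp
qed

lemma tsum_neumann:
  fixes \<theta> :: "'g::{ab_group_add,countable} \<Rightarrow> ennreal"
  assumes "tsum \<theta> \<le> 1 / 2"
  shows "tsum (\<lambda>i. \<Sum>n. conv_power \<theta> n i) < top"
proof -
  have "tsum (\<lambda>i. \<Sum>n. conv_power \<theta> n i) = (\<Sum>n. tsum \<theta> ^ n)"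
    by (subst nn_integral_suminf) (simp_all add: tsum_conv_power)
  also have "\<dots> \<le> (\<Sum>n. ennreal ((1 / 2) ^ n))"
  proof (rule suminf_le)
    fix n
    have "tsum \<theta> ^ n \<le> (1 / 2) ^ n" by (intro power_mono assms) simp
    also have "(1 / 2 :: ennreal) ^ n = ennreal ((1 / 2) ^ n)"
      by (rule half_power_ennreal)
    finally show "tsum \<theta> ^ n \<le> ennreal ((1 / 2) ^ n)" .
  qed auto
  also have "\<dots> < top"
    by (subst suminf_ennreal2) (auto intro: summable_geometric)
  finally show ?thesis .
qed

section \<open>The commutator argument on the integer lattice\<close>

definition supn :: "int ^ 'n \<Rightarrow> int" where
  "supn x = Max (range (\<lambda>c. \<bar>x $ c\<bar>))"

lemma supn_le_iff: "supn x \<le> n \<longleftrightarrow> (\<forall>c. \<bar>x $ c\<bar> \<le> n)"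
  by (auto simp: supn_def)

lemma abs_le_supn: "\<bar>x $ c\<bar> \<le> supn x"
  by (simp add: supn_def)

lemma supn_nonneg: "0 \<le> supn x"
  using abs_le_supn[of x undefined] by linarith

lemma supn_0 [simp]: "supn 0 = 0"
  by (rule antisym) (simp_all add: supn_le_iff supn_nonneg)

lemma supn_minus: "supn (- x) = supn x"
  by (simp add: supn_def)

lemma supn_diff_commute: "supn (x - y) = supn (y - x)"
  using supn_minus[of "x - y"] by simp

lemma supn_triangle: "supn (x + y) \<le> supn x + supn y"
  unfolding supn_le_iff
  by (metis abs_le_supn abs_triangle_ineq add_mono order_trans vector_add_component)

text \<open>Balls of the sup norm are cubes. Their exact count is the source of the constants
  \<open>4 ^ CARD('n)\<close> and \<open>7 ^ CARD('n)\<close> below.\<close>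

lemma
  fixes n :: nat
  shows finite_supn_ball: "finite {x :: int ^ 'n. supn x \<le> int n}"
    and card_supn_ball: "card {x :: int ^ 'n. supn x \<le> int n} = (2 * n + 1) ^ CARD('n)"
proof -
  have eq: "{x :: int ^ 'n. supn x \<le> int n} = vec_lambda ` (PiE UNIV (\<lambda>_. {- int n..int n}))"
  proof (intro equalityI subsetI)
    fix x :: "int ^ 'n" assume "x \<in> {x. supn x \<le> int n}"
    then have "vec_nth x \<in> PiE UNIV (\<lambda>_. {- int n..int n})"
      by (auto simp: supn_le_iff abs_le_iff minus_le_iff)
    then show "x \<in> vec_lambda ` (PiE UNIV (\<lambda>_. {- int n..int n}))"
      by (metis image_eqI vec_nth_inverse)
  qed (auto simp: supn_le_iff abs_le_iff PiE_def Pi_def minus_le_iff)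
  show "finite {x :: int ^ 'n. supn x \<le> int n}"
    unfolding eq by (intro finite_imageI finite_PiE) auto
  have "inj_on vec_lambda (PiE (UNIV :: 'n set) (\<lambda>_. {- int n..int n}))"
    by (rule inj_onI) (metis vec_lambda_inverse UNIV_I)
  then show "card {x :: int ^ 'n. supn x \<le> int n} = (2 * n + 1) ^ CARD('n)"
    unfolding eq by (simp add: card_image card_PiE nat_add_distrib nat_mult_distrib)
qed

text \<open>For N = 0 this is constantly 1, by the value of division by 0; it is a cutoff only for 0
  < N. The Lipschitz constant 1 / N is what makes commutators small.\<close>

definition tent :: "nat \<Rightarrow> int ^ 'n \<Rightarrow> real" where
  "tent N x = max 0 (1 - of_int (supn x) / of_nat N)"

lemma tent_nonneg: "0 \<le> tent N x"
  by (simp add: tent_def)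

lemma tent_le_1: "tent N x \<le> 1"
  using supn_nonneg[of x] by (simp add: tent_def)

lemma tent_minus: "tent N (- x) = tent N x"
  by (simp add: tent_def supn_minus)

lemma tent_0 [simp]: "tent N 0 = 1"
  by (simp add: tent_def)

lemma tent_eq_0: "0 < N \<Longrightarrow> int N \<le> supn x \<Longrightarrow> tent N x = 0"
  by (simp add: tent_def le_divide_eq)

lemma tent_lipschitz:
  assumes "0 < N"
  shows "\<bar>tent N x - tent N y\<bar> \<le> min 1 (of_int (supn (x - y)) / of_nat N)"
proof -
  have "supn x \<le> supn (x - y) + supn y" "supn y \<le> supn (x - y) + supn x"
    using supn_triangle[of "x - y" y] supn_triangle[of "y - x" x] by (simp_all add: supn_diff_commute)
  then have "\<bar>real_of_int (supn x) - of_int (supn y)\<bar> \<le> of_int (supn (x - y))"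
    by linarith
  then have "\<bar>of_int (supn x) / of_nat N - of_int (supn y) / real N\<bar> \<le> of_int (supn (x - y)) / of_nat N"
    using assms by (simp add: diff_divide_distrib[symmetric] divide_right_mono)
  moreover have "\<bar>tent N x - tent N y\<bar> \<le> 1"
    using tent_nonneg[of N x] tent_le_1[of N x] tent_nonneg[of N y] tent_le_1[of N y] by linarith
  ultimately show ?thesis by (auto simp: tent_def)
qed

text \<open>
  Bounds the commutator of multiplication by \<open>\<psi>\<close> with an operator dominated by convolution with \<open>a\<close>.
\<close>

definition commutator_bound ::
    "('g::ab_group_add \<Rightarrow> ennreal) \<Rightarrow> ('g \<Rightarrow> real) \<Rightarrow> ('g \<Rightarrow> ennreal) \<Rightarrow> 'g \<Rightarrow> ennreal" where
  "commutator_bound a \<psi> b i = tsum (\<lambda>j. a (i - j) * ennreal \<bar>\<psi> i - \<psi> j\<bar> * b j)"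

text \<open>Dominated convergence with majorant \<open>a\<close>: for fixed r the factor tends to 0
  as n grows. The width is taken even, 2 n, so that the tent is at least 1 / 2 on the ball of
  integer radius n in \<open>tent_counting\<close>.\<close>

lemma tent_commutator_small:
  fixes a :: "int ^ 'n \<Rightarrow> ennreal"
  assumes "tsum a < top" "C < top"
  obtains n :: nat where "0 < n"
    "C * tsum (\<lambda>r. a r * ennreal (min 1 (of_int (supn r) / of_nat (2 * n)))) \<le> 1 / 2"
proof -
  let ?m = "\<lambda>(n::nat) r :: int ^ 'n. ennreal (min 1 (of_int (supn r) / of_nat (2 * n)))"
  have "(\<lambda>n. tsum (\<lambda>r. a r * ?m n r)) \<longlonglongrightarrow> tsum (\<lambda>r :: int ^ 'n. 0)"
  proof (rule nn_integral_dominated_convergence[where w = a])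
    show "AE r in count_space UNIV. a r * ?m n r \<le> a r" for n
      by (auto intro!: mult_left_mono[of _ 1 "a _", simplified])
    show "AE r in count_space UNIV. (\<lambda>n. a r * ?m n r) \<longlonglongrightarrow> 0"
    proof (rule AE_I2)
      fix r :: "int ^ 'n"
      have "(\<lambda>n. of_int (supn r) / of_nat (2 * n)) \<longlonglongrightarrow> (0::real)"
        by real_asymp
      then have "(\<lambda>n. min 1 (of_int (supn r) / of_nat (2 * n))) \<longlonglongrightarrow> min 1 (0::real)"
        by (intro tendsto_min tendsto_const)
      then have "(\<lambda>n. ?m n r) \<longlonglongrightarrow> ennreal 0"
        by (intro tendsto_ennrealI) simp
      moreover have "a r < top" using le_tsum[of a r] assms(1) by (rule le_less_trans)
      ultimately have "(\<lambda>n. a r * ?m n r) \<longlonglongrightarrow> a r * ennreal 0"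
        by (intro ennreal_tendsto_cmult)
      then show "(\<lambda>n. a r * ?m n r) \<longlonglongrightarrow> 0" by simp
    qed
  qed (use assms in auto)
  then have "(\<lambda>n. C * tsum (\<lambda>r. a r * ?m n r)) \<longlonglongrightarrow> C * 0"
    by (intro ennreal_tendsto_cmult assms) simp
  then have "eventually (\<lambda>n. C * tsum (\<lambda>r. a r * ?m n r) < 1 / 2) sequentially"
    by (rule order_tendstoD) (simp add: ennreal_zero_less_divide)
  then have "eventually (\<lambda>n. C * tsum (\<lambda>r. a r * ?m n r) < 1 / 2 \<and> 0 < n) sequentially"
    using eventually_gt_at_top[of 0] by (rule eventually_conj)
  then obtain n where "C * tsum (\<lambda>r. a r * ?m n r) < 1 / 2" "0 < n"
    by (auto simp: eventually_sequentially)
  then show ?thesis by (intro that[of n]) auto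
qed

text \<open>F and the number of lattice points with \<open>supn x < 4 n\<close> are both of order
  n^d, so their quotient is bounded independently of n.\<close>

lemma tent_counting:
  assumes n: "0 < n"
  defines "F \<equiv> tsum (\<lambda>x :: int ^ 'n. ennreal (tent (2 * n) x))"
  shows "0 < F" "F < top"
    "1 / F * tsum (\<lambda>x :: int ^ 'n. indicator {x. supn x < 2 * int (2 * n)} x) \<le> 2 * 4 ^ CARD('n)"
proof -
  let ?B = "\<lambda>m. {x :: int ^ 'n. supn x \<le> int m}"
  have tsum_ball: "tsum (\<lambda>x. c * indicator (?B m) x) = c * of_nat ((2 * m + 1) ^ CARD('n))" for m c
    using finite_supn_ball[of m, where 'n = 'n] card_supn_ball[of m, where 'n = 'n]
    by (simp add: nn_integral_cmult_indicator)
  have "F \<le> tsum (\<lambda>x. 1 * indicator (?B (2 * n)) x)"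
    unfolding F_def
  proof (rule nn_integral_mono)
    fix x :: "int ^ 'n"
    show "ennreal (tent (2 * n) x) \<le> 1 * indicator (?B (2 * n)) x"
      using tent_le_1[of "2 * n" x] tent_eq_0[of "2 * n" x] n by (auto split: split_indicator)
  qed
  also have "\<dots> < top" unfolding tsum_ball by (simp add: ennreal_mult_less_top power_less_top_ennreal of_nat_less_top)
  finally show Ftop: "F < top" .
  \<comment> \<open>On the ball of radius n the tent of width 2 n is at least 1 / 2, so F is at
    least half the number of points of that ball.\<close>
  have half: "ennreal (1 / 2) * of_nat ((2 * n + 1) ^ CARD('n)) \<le> F"
    unfolding F_def tsum_ball[symmetric]
  proof (rule nn_integral_mono)
    fix x :: "int ^ 'n"
    have "1 / 2 \<le> tent (2 * n) x" if "supn x \<le> int n"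
    proof -
      have "real_of_int (supn x) / of_nat (2 * n) \<le> 1 / 2"
        using that n by (simp add: divide_le_eq)
      then show ?thesis by (simp add: tent_def)
    qed
    then show "ennreal (1 / 2) * indicator (?B n) x \<le> ennreal (tent (2 * n) x)"
      by (auto split: split_indicator intro!: ennreal_leI simp del: ennreal_half)
  qed
  have "0 < ennreal (1 / 2) * of_nat ((2 * n + 1) ^ CARD('n))"
    by (simp only: ennreal_zero_less_mult_iff ennreal_of_nat_eq_real_of_nat ennreal_less_zero_iff) simp
  then show F0: "0 < F" using half by (rule less_le_trans)
  have "tsum (\<lambda>x :: int ^ 'n. indicator {x. supn x < 2 * int (2 * n)} x)
      \<le> tsum (\<lambda>x. 1 * indicator (?B (4 * n)) x)"
    by (intro nn_integral_mono) (auto split: split_indicator)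
  also have "\<dots> = of_nat ((2 * (4 * n) + 1) ^ CARD('n))"
    unfolding tsum_ball by simp
  \<comment> \<open>8 n + 1 \<le> 4 (2 n + 1) compares the ball of radius 4 n with the one of radius
    n.\<close>
  also have "\<dots> \<le> of_nat ((4 * (2 * n + 1)) ^ CARD('n))"
    by (intro of_nat_mono power_mono) auto
  also have "\<dots> = (2 * 4 ^ CARD('n)) * (ennreal (1 / 2) * of_nat ((2 * n + 1) ^ CARD('n)))"
  proof -
    have "2 * ennreal (1 / 2) = 1"
      by (simp add: ennreal_mult'[symmetric] flip: ennreal_numeral del: ennreal_half)
    moreover have "(of_nat ((4 * (2 * n + 1)) ^ CARD('n)) :: ennreal)
        = 4 ^ CARD('n) * of_nat ((2 * n + 1) ^ CARD('n))"
      by (simp only: power_mult_distrib of_nat_mult of_nat_power of_nat_numeral)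
    ultimately have "(of_nat ((4 * (2 * n + 1)) ^ CARD('n)) :: ennreal)
        = (2 * ennreal (1 / 2)) * (4 ^ CARD('n) * of_nat ((2 * n + 1) ^ CARD('n)))"
      by (simp only: mult_1_left)
    then show ?thesis by (simp only: mult_ac)
  qed
  also have "\<dots> \<le> (2 * 4 ^ CARD('n)) * F"
    by (intro mult_left_mono half) simp
  finally have "1 / F * tsum (\<lambda>x :: int ^ 'n. indicator {x. supn x < 2 * int (2 * n)} x)
      \<le> 1 / F * ((2 * 4 ^ CARD('n)) * F)"
    by (intro mult_left_mono) auto
  also have "\<dots> = (2 * 4 ^ CARD('n)) * (F / F)"
    by (simp add: ennreal_times_divide ennreal_divide_times mult.commute)
  finally show "1 / F * tsum (\<lambda>x :: int ^ 'n. indicator {x. supn x < 2 * int (2 * n)} x) \<le> 2 * 4 ^ CARD('n)"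
    using F0 Ftop by simp
qed

text \<open>Inserting the partition of unity into \<open>b\<close> bounds the commutator with the
  cutoff at k by the localised pieces of \<open>b\<close> at all l. The coefficient depends only on
  k - l, so the bound is a convolution over the positions of the cutoffs.\<close>

lemma tent_commutator_bound:
  fixes a b :: "int ^ 'n \<Rightarrow> ennreal"
  assumes n: "0 < N" and p: "1 \<le> p"
  defines "F \<equiv> tsum (\<lambda>x :: int ^ 'n. ennreal (tent N x))"
  defines "G \<equiv> indicator {x :: int ^ 'n. supn x < 2 * int N} :: _ \<Rightarrow> ennreal"
  defines "m \<equiv> \<lambda>r :: int ^ 'n. ennreal (min 1 (of_int (supn r) / of_nat N))"
  defines "\<epsilon> \<equiv> \<lambda>s. 1 / F * tsum (\<lambda>r. a r * m r * (G s + G (s - r)))"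
  assumes F: "0 < F" "F < top"
  shows "seq_norm p (commutator_bound a (\<lambda>i. tent N (i - k)) b)
     \<le> conv \<epsilon> (\<lambda>l. seq_norm p (\<lambda>i. ennreal (tent N (i - l)) * b i)) k"
proof -
  let ?u = "\<lambda>l i. ennreal (tent N (i - l)) * b i"
  have F1: "1 / F * F = 1" using F by (simp add: ennreal_divide_times)
  \<comment> \<open>The translated tents form a partition of unity up to the factor \<open>F\<close>.\<close>
  have split_b: "b j = tsum (\<lambda>l. 1 / F * ?u l j)" for j
  proof -
    have "tsum (\<lambda>l. 1 / F * ?u l j) = 1 / F * (tsum (\<lambda>l. ennreal (tent N (j - l))) * b j)"
      by (simp add: nn_integral_cmult nn_integral_multc)
    also have "\<dots> = 1 / F * F * b j" using tsum_reflect[of "\<lambda>x. ennreal (tent N x)" j] by (simp add: F_def mult.assoc)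
    finally show ?thesis by (simp add: F1)
  qed
  \<comment> \<open>The difference of tents forces i or i - r to lie within N of k, and
    \<open>?u l (i - r)\<close> forces i - r to lie within N of l. Hence k - l - r or k - l has norm
    below 2 N, which is what G records.\<close>
  have key: "ennreal \<bar>tent N (i - k) - tent N (i - r - k)\<bar> * ?u l (i - r)
      \<le> m r * (G (k - l) + G (k - l - r)) * ?u l (i - r)" for i r l
  proof (cases "supn (i - r - l) < int N \<and> (supn (i - k) < int N \<or> supn (i - r - k) < int N)")
    case True
    have "supn (k - l) \<le> supn (k - (i - r)) + supn (i - r - l)"
      "supn (k - l - r) \<le> supn (k - i) + supn (i - r - l)"
      using supn_triangle[of "k - (i - r)" "i - r - l"] supn_triangle[of "k - i" "i - r - l"]
      by (simp_all add: algebra_simps)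
    then have "1 \<le> G (k - l) + G (k - l - r)"
      using True by (auto simp: G_def supn_diff_commute split: split_indicator)
    moreover have "ennreal \<bar>tent N (i - k) - tent N (i - r - k)\<bar> \<le> m r"
      using tent_lipschitz[OF n, of "i - k" "i - r - k"] by (auto simp: m_def intro!: ennreal_leI)
    ultimately have "ennreal \<bar>tent N (i - k) - tent N (i - r - k)\<bar> * 1 \<le> m r * (G (k - l) + G (k - l - r))"
      by (intro mult_mono) auto
    then show ?thesis by (intro mult_right_mono) auto
  next
    case False
    then consider "int N \<le> supn (i - r - l)" | "int N \<le> supn (i - k)" "int N \<le> supn (i - r - k)"
      by linarith
    then show ?thesis
      by cases (simp_all add: tent_eq_0[OF n])
  qed
  have "commutator_bound a (\<lambda>i. tent N (i - k)) b i
      \<le> tsum (\<lambda>r. tsum (\<lambda>l. (1 / F * (a r * (m r * (G (k - l) + G (k - l - r))))) * ?u l (i - r)))" for i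
  proof -
    have "commutator_bound a (\<lambda>i. tent N (i - k)) b i
        = tsum (\<lambda>r. a r * ennreal \<bar>tent N (i - k) - tent N (i - r - k)\<bar> * b (i - r))"
      unfolding commutator_bound_def
      using tsum_reflect[of "\<lambda>r. a r * ennreal \<bar>tent N (i - k) - tent N (i - r - k)\<bar> * b (i - r)" i]
      by simp
    also have "\<dots> = tsum (\<lambda>r. tsum (\<lambda>l. (1 / F * a r) * (ennreal \<bar>tent N (i - k) - tent N (i - r - k)\<bar> * ?u l (i - r))))"
      by (subst split_b) (simp add: nn_integral_cmult[symmetric] mult_ac)
    also have "\<dots> \<le> tsum (\<lambda>r. tsum (\<lambda>l. (1 / F * a r) * (m r * (G (k - l) + G (k - l - r)) * ?u l (i - r))))"
      by (intro nn_integral_mono mult_left_mono key) simp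
    finally show ?thesis by (simp only: mult.assoc)
  qed
  then have "seq_norm p (commutator_bound a (\<lambda>i. tent N (i - k)) b)
      \<le> seq_norm p (\<lambda>i. tsum (\<lambda>r. tsum (\<lambda>l. (1 / F * (a r * (m r * (G (k - l) + G (k - l - r))))) * ?u l (i - r))))"
    by (intro Np_mono p) auto
  also have "\<dots> \<le> tsum (\<lambda>r. seq_norm p (\<lambda>i. tsum (\<lambda>l. (1 / F * (a r * (m r * (G (k - l) + G (k - l - r))))) * ?u l (i - r))))"
    by (rule Np_sum_le) (auto simp: p)
  also have "\<dots> \<le> tsum (\<lambda>r. tsum (\<lambda>l. seq_norm p (\<lambda>i. (1 / F * (a r * (m r * (G (k - l) + G (k - l - r))))) * ?u l (i - r))))"
    by (intro nn_integral_mono Np_sum_le) (auto simp: p)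
  also have "\<dots> \<le> tsum (\<lambda>r. tsum (\<lambda>l. (1 / F * (a r * (m r * (G (k - l) + G (k - l - r))))) * seq_norm p (?u l)))"
  proof (intro nn_integral_mono)
    fix r l
    have "seq_norm p (\<lambda>i. (1 / F * (a r * (m r * (G (k - l) + G (k - l - r))))) * ?u l (i - r))
        \<le> (1 / F * (a r * (m r * (G (k - l) + G (k - l - r))))) * seq_norm p (\<lambda>i. ?u l (i - r))"
      by (rule Np_cmult_le) (auto simp: p)
    also have "seq_norm p (\<lambda>i. ?u l (i - r)) = seq_norm p (?u l)"
      by (rule seq_norm_shift)
    finally show "seq_norm p (\<lambda>i. (1 / F * (a r * (m r * (G (k - l) + G (k - l - r))))) * ?u l (i - r))
        \<le> (1 / F * (a r * (m r * (G (k - l) + G (k - l - r))))) * seq_norm p (?u l)" .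
  qed
  also have "\<dots> = conv \<epsilon> (\<lambda>l. seq_norm p (?u l)) k"
    unfolding conv_def \<epsilon>_def by (subst tsum_swap) (simp add: nn_integral_cmult nn_integral_multc, simp add: mult.assoc)
  finally show ?thesis .
qed

text \<open>The inequality over \<psi> is all that is used of the operator, and it is applied to
  translated tents of one fixed width. W is built from \<open>a\<close> and \<open>C\<close> alone,
  so it serves all pairs \<open>b\<close>, \<open>b'\<close> at once.\<close>

theorem wiener_discrete:
  fixes a :: "int ^ 'n \<Rightarrow> ennreal"
  assumes p: "1 \<le> p" and a: "tsum a < top" and C: "C < top"
  obtains W :: "int ^ 'n \<Rightarrow> ennreal" where "tsum W < top"
    "\<And>b b' i. seq_norm p b < top \<Longrightarrow>
       (\<And>\<psi>. (\<And>i. 0 \<le> \<psi> i) \<Longrightarrow> (\<And>i. \<psi> i \<le> 1) \<Longrightarrow>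
          seq_norm p (\<lambda>i. ennreal (\<psi> i) * b i)
            \<le> C * seq_norm p (\<lambda>i. ennreal (\<psi> i) * b' i + commutator_bound a \<psi> b i)) \<Longrightarrow>
       b i \<le> conv W b' i"
proof -
  \<comment> \<open>4 * 4 ^ d is the constant of \<open>tent_counting\<close> times 2, for the two
    indicators \<open>G s\<close> and \<open>G (s - r)\<close>.\<close>
  have "C * (4 * 4 ^ CARD('n)) < top"
    using C by (simp add: ennreal_mult_less_top power_less_top_ennreal)
  then obtain n :: nat where n: "0 < n" and small: "C * (4 * 4 ^ CARD('n)) *
      tsum (\<lambda>r. a r * ennreal (min 1 (of_int (supn r) / of_nat (2 * n)))) \<le> 1 / 2"
    using tent_commutator_small[OF a] by blast
  define N where "N = 2 * n"
  have N: "0 < N" using n by (simp add: N_def)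
  define F where "F = tsum (\<lambda>x :: int ^ 'n. ennreal (tent N x))"
  define G where "G = (indicator {x :: int ^ 'n. supn x < 2 * int N} :: _ \<Rightarrow> ennreal)"
  define m where "m = (\<lambda>r :: int ^ 'n. ennreal (min 1 (of_int (supn r) / of_nat N)))"
  define \<epsilon> where "\<epsilon> = (\<lambda>s. 1 / F * tsum (\<lambda>r. a r * m r * (G s + G (s - r))))"
  note F = tent_counting[OF n, where 'n = 'n, folded N_def, folded F_def G_def]
  define \<theta> where "\<theta> = (\<lambda>s. C * \<epsilon> s)"
  have "tsum \<epsilon> = 1 / F * tsum (\<lambda>r. tsum (\<lambda>s. a r * m r * (G s + G (s - r))))"
    unfolding \<epsilon>_def by (subst nn_integral_cmult) (simp, subst tsum_swap, rule refl)
  also have "\<dots> = 2 * (1 / F * tsum G) * tsum (\<lambda>r. a r * m r)"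
  proof -
    have "tsum (\<lambda>s. a r * m r * (G s + G (s - r))) = 2 * tsum G * (a r * m r)" for r
      by (simp add: nn_integral_cmult nn_integral_add tsum_shift mult_2[symmetric] mult_ac)
    then have "tsum (\<lambda>r. tsum (\<lambda>s. a r * m r * (G s + G (s - r)))) = tsum (\<lambda>r. 2 * tsum G * (a r * m r))"
      by (simp only:)
    also have "\<dots> = 2 * tsum G * tsum (\<lambda>r. a r * m r)"
      by (rule nn_integral_cmult) simp
    finally show ?thesis by (simp only: mult_ac)
  qed
  also have "\<dots> \<le> 2 * (2 * 4 ^ CARD('n)) * tsum (\<lambda>r. a r * m r)"
    using F(3) by (intro mult_right_mono mult_left_mono) auto
  finally have "tsum \<epsilon> \<le> (4 * 4 ^ CARD('n)) * tsum (\<lambda>r. a r * m r)"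
    by (simp add: mult.assoc[symmetric])
  then have "C * tsum \<epsilon> \<le> C * ((4 * 4 ^ CARD('n)) * tsum (\<lambda>r. a r * m r))"
    by (rule mult_left_mono) simp
  also have "\<dots> \<le> 1 / 2" using small by (simp add: m_def N_def mult.assoc)
  finally have \<theta>: "tsum \<theta> \<le> 1 / 2" by (simp add: \<theta>_def nn_integral_cmult)
  define U where "U = (\<lambda>i. \<Sum>n. conv_power \<theta> n i)"
  define f where "f = (\<lambda>x :: int ^ 'n. ennreal (tent N x))"
  define W where "W = (\<lambda>i. C * conv U f i)"
  have "tsum W = C * (tsum U * F)"
    by (simp add: W_def nn_integral_cmult tsum_conv F_def f_def)
  also have "\<dots> < top"
    using C F tsum_neumann[OF \<theta>] by (simp add: ennreal_mult_less_top U_def)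
  finally have W: "tsum W < top" .
  show ?thesis
  proof (rule that[OF W])
    fix b b' :: "int ^ 'n \<Rightarrow> ennreal" and i
    assume b: "seq_norm p b < top"
      and hyp: "\<And>\<psi>. (\<And>i. 0 \<le> \<psi> i) \<Longrightarrow> (\<And>i. \<psi> i \<le> 1) \<Longrightarrow>
          seq_norm p (\<lambda>i. ennreal (\<psi> i) * b i)
            \<le> C * seq_norm p (\<lambda>i. ennreal (\<psi> i) * b' i + commutator_bound a \<psi> b i)"
    define \<beta> where "\<beta> = (\<lambda>k. seq_norm p (\<lambda>i. f (i - k) * b i))"
    define \<gamma> where "\<gamma> = (\<lambda>k. C * seq_norm p (\<lambda>i. f (i - k) * b' i))"
    have "\<beta> k \<le> \<gamma> k + conv \<theta> \<beta> k" for k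
    proof -
      have "\<beta> k \<le> C * seq_norm p (\<lambda>i. f (i - k) * b' i + commutator_bound a (\<lambda>i. tent N (i - k)) b i)"
        unfolding \<beta>_def f_def by (rule hyp) (auto simp: tent_nonneg tent_le_1)
      also have "\<dots> \<le> C * (seq_norm p (\<lambda>i. f (i - k) * b' i) + conv \<epsilon> \<beta> k)"
      proof (rule mult_left_mono)
        have "seq_norm p (\<lambda>i. f (i - k) * b' i + commutator_bound a (\<lambda>i. tent N (i - k)) b i)
            \<le> seq_norm p (\<lambda>i. f (i - k) * b' i) + seq_norm p (commutator_bound a (\<lambda>i. tent N (i - k)) b)"
          by (rule Np_add_le) (auto simp: p)
        also have "seq_norm p (commutator_bound a (\<lambda>i. tent N (i - k)) b) \<le> conv \<epsilon> \<beta> k"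
          using tent_commutator_bound[OF N p, where 'n = 'n, folded F_def, OF F(1,2), of a k b]
          by (simp only: \<epsilon>_def \<beta>_def f_def m_def G_def)
        finally show "seq_norm p (\<lambda>i. f (i - k) * b' i + commutator_bound a (\<lambda>i. tent N (i - k)) b i)
            \<le> seq_norm p (\<lambda>i. f (i - k) * b' i) + conv \<epsilon> \<beta> k"
          by (simp add: add_left_mono)
      qed simp
      finally show ?thesis
        by (simp add: distrib_left \<gamma>_def \<theta>_def conv_cmult_left)
    qed
    \<comment> \<open>This is finite because \<open>b\<close> lies in l^p, and it provides the a
      priori bound for \<open>neumann_le\<close>.\<close>
    moreover have "\<beta> k \<le> seq_norm p b" for k
      unfolding \<beta>_def f_def
    proof (intro Np_mono p)
      fix i
      have "ennreal (tent N (i - k)) * b i \<le> 1 * b i"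
        by (intro mult_right_mono) (auto simp: tent_le_1)
      then show "ennreal (tent N (i - k)) * b i \<le> b i" by simp
    qed simp
    ultimately have "\<beta> i \<le> conv U \<gamma> i"
      unfolding U_def by (intro neumann_le[OF \<theta> _ b])
    \<comment> \<open>For \<open>b'\<close> the l^p norm of a localised piece may be enlarged to its
      l^1 norm, which is a convolution because the tent is even.\<close>
    also have "\<dots> \<le> conv U (\<lambda>k. C * conv f b' k) i"
    proof (rule conv_mono)
      fix k
      have "seq_norm p (\<lambda>i. f (i - k) * b' i) \<le> tsum (\<lambda>i. f (i - k) * b' i)"
        by (rule seq_norm_le_tsum[OF p])
      also have "\<dots> = conv f b' k"
        unfolding conv_def f_def by (subst tent_minus[symmetric]) simp
      finally show "\<gamma> k \<le> C * conv f b' k" by (simp add: \<gamma>_def mult_left_mono)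
    qed simp
    also have "\<dots> = conv W b' i"
      by (simp add: W_def conv_cmult_right conv_cmult_left conv_assoc)
    finally have "\<beta> i \<le> conv W b' i" .
    \<comment> \<open>The tent is 1 at its centre.\<close>
    moreover have "b i \<le> \<beta> i"
      using le_seq_norm[OF p, of "\<lambda>j. f (j - i) * b j" i] by (simp add: \<beta>_def f_def)
    ultimately show "b i \<le> conv W b' i" by simp
  qed
qed

section \<open>Discretisation on unit cells\<close>

definition fl :: "real ^ 'n \<Rightarrow> int ^ 'n" where
  "fl x = (\<chi> c. \<lfloor>x $ c\<rfloor>)"

lemma fl_nth [simp]: "fl x $ c = \<lfloor>x $ c\<rfloor>"
  by (simp add: fl_def)

definition cell :: "int ^ 'n \<Rightarrow> (real ^ 'n) set" where
  "cell i = {x. fl x = i}"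

lemma cell_eq: "cell i = (\<Inter>c. {x. of_int (i $ c) \<le> x $ c} \<inter> {x. x $ c < of_int (i $ c) + 1})"
  by (auto simp: cell_def vec_eq_iff floor_eq_iff)

lemma cell_borel [measurable]: "cell i \<in> sets borel"
  unfolding cell_eq
  by (intro sets.countable_INT'' sets.Int borel_closed borel_open closed_Collect_le open_Collect_less
      continuous_intros) auto

lemma measurable_fl [measurable]: "fl \<in> borel \<rightarrow>\<^sub>M count_space UNIV"
proof -
  have "fl -` {i} \<inter> space borel \<in> sets borel" for i :: "int ^ 'n"
    using cell_borel[of i] by (simp add: cell_def vimage_def)
  then show ?thesis by (subst measurable_count_space_eq2_countable) auto
qed

lemma emeasure_cell_le:
  fixes i :: "int ^ 'n"
  shows "emeasure lborel (cell i) \<le> 1"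
proof -
  let ?l = "(\<chi> c. real_of_int (i $ c)) :: real ^ 'n" and ?u = "(\<chi> c. real_of_int (i $ c) + 1) :: real ^ 'n"
  have "cell i \<subseteq> cbox ?l ?u"
    by (auto simp: cell_eq mem_box_cart) (meson less_imp_le)
  then have "emeasure lborel (cell i) \<le> emeasure lborel (cbox ?l ?u)"
    by (rule emeasure_mono) simp
  also have "\<dots> = 1"
  proof -
    have "(?u - ?l) \<bullet> b = 1" if "b \<in> Basis" for b :: "real ^ 'n"
      using that by (auto simp: Basis_vec_def inner_axis)
    moreover have "?l \<bullet> b \<le> ?u \<bullet> b" if "b \<in> Basis" for b :: "real ^ 'n"
      using that by (auto simp: Basis_vec_def inner_axis)
    ultimately show ?thesis by (simp add: emeasure_lborel_cbox_eq)
  qed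
  finally show ?thesis .
qed

lemma tsum_cells: "tsum (\<lambda>i. indicator (cell i) x * g i) = g (fl x)"
proof -
  have "tsum (\<lambda>i. indicator (cell i) x * g i) = tsum (\<lambda>i. g i * indicator {fl x} i)"
    by (intro nn_integral_cong) (auto simp: cell_def split: split_indicator)
  then show ?thesis by simp
qed

lemma nn_integral_cells:
  assumes [measurable]: "f \<in> borel_measurable borel"
  shows "(\<integral>\<^sup>+x. f x \<partial>lborel) = tsum (\<lambda>i. \<integral>\<^sup>+x. indicator (cell i) x * f x \<partial>lborel)"
  by (subst nn_integral_count_space_nn_integral[symmetric]) (auto simp: tsum_cells)

definition cell_norm :: "ennreal \<Rightarrow> (real ^ 'n \<Rightarrow> complex) \<Rightarrow> int ^ 'n \<Rightarrow> ennreal" where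
  "cell_norm p f i = Np p lborel (\<lambda>x. indicator (cell i) x * ennreal (cmod (f x)))"

lemma cell_norm_cong_AE:
  assumes "f \<in> borel_measurable borel" "g \<in> borel_measurable borel" "AE x in lborel. f x = g x" "1 \<le> p"
  shows "cell_norm p f = cell_norm p g"
  unfolding cell_norm_def[abs_def]
proof (intro ext Np_cong_AE assms(4))
  fix i
  show "AE x in lborel. indicator (cell i) x * ennreal (cmod (f x)) = indicator (cell i) x * ennreal (cmod (g x))"
    using assms(3) by eventually_elim simp
qed (use assms(1,2) in measurable)

lemma cell_norm_add_le:
  assumes [measurable]: "f \<in> borel_measurable borel" "g \<in> borel_measurable borel" and p: "1 \<le> p"
  shows "cell_norm p (\<lambda>x. f x + g x) i \<le> cell_norm p f i + cell_norm p g i"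
proof -
  have "cell_norm p (\<lambda>x. f x + g x) i
      \<le> Np p lborel (\<lambda>x. indicator (cell i) x * ennreal (cmod (f x)) + indicator (cell i) x * ennreal (cmod (g x)))"
    unfolding cell_norm_def
    by (rule Np_mono)
      (auto simp: p norm_triangle_ineq split: split_indicator simp flip: ennreal_plus)
  also have "\<dots> \<le> cell_norm p f i + cell_norm p g i"
    unfolding cell_norm_def by (rule Np_add_le) (auto simp: p)
  finally show ?thesis .
qed

text \<open>Cutoffs are taken constant on cells. They then act on cell norms by exact
  multiplication, and commutators involve only the lattice differences \<psi> i - \<psi> j.\<close>

lemma cell_norm_mult_step:
  assumes [measurable]: "f \<in> borel_measurable borel" and p: "1 \<le> p"
  shows "cell_norm p (\<lambda>x. c (fl x) * f x) i = ennreal (cmod (c i)) * cell_norm p f i"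
proof -
  have "cell_norm p (\<lambda>x. c (fl x) * f x) i
      = Np p lborel (\<lambda>x. ennreal (cmod (c i)) * (indicator (cell i) x * ennreal (cmod (f x))))"
    unfolding cell_norm_def
    by (intro arg_cong[where f = "Np p lborel"] ext)
      (auto simp: cell_def norm_mult ennreal_mult split: split_indicator)
  also have "\<dots> = ennreal (cmod (c i)) * cell_norm p f i"
    unfolding cell_norm_def by (rule Np_cmult) (auto simp: p)
  finally show ?thesis .
qed

lemma Np_cells:
  fixes f :: "real ^ 'n \<Rightarrow> complex"
  assumes [measurable]: "f \<in> borel_measurable borel" and p: "1 \<le> p"
  shows "Np p lborel (\<lambda>x. ennreal (cmod (f x))) = seq_norm p (cell_norm p f)"
proof (cases "p = \<infinity>")
  case True
  let ?e = "\<lambda>i. esssup lborel (\<lambda>x. indicator (cell i) x * ennreal (cmod (f x)))"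
  have le_e: "?e i \<le> esssup (count_space UNIV) ?e" for i
    using esssup_AE[where M = "count_space UNIV" and f = ?e] by (simp add: AE_count_space)
  have "esssup lborel (\<lambda>x. ennreal (cmod (f x))) \<le> esssup (count_space UNIV) ?e"
  proof (rule esssup_I)
    have "AE x in lborel. \<forall>i. indicator (cell i) x * ennreal (cmod (f x)) \<le> ?e i"
      by (subst AE_all_countable) (auto intro: esssup_AE)
    then show "AE x in lborel. ennreal (cmod (f x)) \<le> esssup (count_space UNIV) ?e"
    proof (eventually_elim)
      case (elim x)
      have "ennreal (cmod (f x)) = indicator (cell (fl x)) x * ennreal (cmod (f x))"
        by (simp add: cell_def)
      also have "\<dots> \<le> esssup (count_space UNIV) ?e"
        using elim[rule_format, of "fl x"] le_e by (rule order_trans)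
      finally show ?case .
    qed
  qed simp
  moreover have "esssup (count_space UNIV) ?e \<le> esssup lborel (\<lambda>x. ennreal (cmod (f x)))"
    by (intro esssup_I) (auto simp: AE_count_space intro!: esssup_mono split: split_indicator)
  ultimately show ?thesis using True by (simp add: Np_def cell_norm_def[abs_def])
next
  case False
  let ?r = "enn2real p"
  have "(\<integral>\<^sup>+x. epowr (ennreal (cmod (f x))) ?r \<partial>lborel)
      = tsum (\<lambda>i. \<integral>\<^sup>+x. indicator (cell i) x * epowr (ennreal (cmod (f x))) ?r \<partial>lborel)"
    by (rule nn_integral_cells) simp
  also have "\<dots> = tsum (\<lambda>i. \<integral>\<^sup>+x. epowr (indicator (cell i) x * ennreal (cmod (f x))) ?r \<partial>lborel)"
    by (intro nn_integral_cong) (auto split: split_indicator)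
  also have "\<dots> = tsum (\<lambda>i. epowr (cell_norm p f i) ?r)"
    using p False by (simp add: cell_norm_def epowr_Np)
  finally show ?thesis using False by (simp add: Np_def)
qed

lemma Lp_eq_Np: "Lp p = {f \<in> borel_measurable borel. Np p lborel (\<lambda>x. ennreal (cmod (f x))) < top}"
  by (auto simp: Lp_def Np_def epowr_ennreal)

lemma Lp_iff:
  "1 \<le> p \<Longrightarrow> f \<in> Lp p \<longleftrightarrow> f \<in> borel_measurable borel \<and> seq_norm p (cell_norm p f) < top"
  by (auto simp: Lp_eq_Np Np_cells)

lemma Lp_measurable: "f \<in> Lp p \<Longrightarrow> f \<in> borel_measurable borel"
  by (simp add: Lp_def)

lemma Lp_norm_eq:
  assumes "1 \<le> p" "f \<in> Lp p"
  shows "ennreal (Lp_norm p f) = seq_norm p (cell_norm p f)"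
proof -
  have "Lp_norm p f = enn2real (Np p lborel (\<lambda>x. ennreal (cmod (f x))))"
  proof (cases "p = \<infinity>")
    case False
    have "(\<integral>\<^sup>+x. ennreal (cmod (f x) powr enn2real p) \<partial>lborel) < top"
      using assms(2) False by (simp add: Lp_def)
    then show ?thesis
      using False by (simp add: Lp_norm_def Np_def epowr_ennreal epowr_def)
  qed (simp add: Lp_norm_def Np_def)
  then show ?thesis
    using assms by (simp add: Lp_iff Np_cells)
qed

text \<open>Jensen's inequality on a cell, whose measure is at most 1. Together with
  \<open>cell_norm_le\<close>, which passes from a sup bound to the L^p norm, it lets dominated
  kernels be treated alike for all p.\<close>

lemma nn_integral_cell_le:
  assumes [measurable]: "f \<in> borel_measurable borel" and p: "1 \<le> p"
  shows "(\<integral>\<^sup>+x. indicator (cell i) x * ennreal (cmod (f x)) \<partial>lborel) \<le> cell_norm p f i"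
proof (cases "p = \<infinity>")
  case True
  let ?f = "\<lambda>x. indicator (cell i) x * ennreal (cmod (f x))"
  have "AE x in lborel. ?f x \<le> esssup lborel ?f * indicator (cell i) x"
    using esssup_AE[where M = lborel and f = ?f] by eventually_elim (auto split: split_indicator)
  then have "(\<integral>\<^sup>+x. ?f x \<partial>lborel) \<le> (\<integral>\<^sup>+x. esssup lborel ?f * indicator (cell i) x \<partial>lborel)"
    by (rule nn_integral_mono_AE)
  also have "\<dots> = esssup lborel ?f * emeasure lborel (cell i)"
    by (simp add: nn_integral_cmult_indicator)
  also have "\<dots> \<le> esssup lborel ?f * 1"
    by (intro mult_left_mono emeasure_cell_le) simp
  finally show ?thesis using True by (simp add: cell_norm_def Np_def)
next
  case False
  let ?r = "enn2real p" and ?\<mu> = "density lborel (indicator (cell i))"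
  have r: "1 \<le> ?r" using one_le_enn2real[OF p False] .
  have "epowr (\<integral>\<^sup>+x. ennreal (cmod (f x)) \<partial>?\<mu>) ?r \<le> (\<integral>\<^sup>+x. epowr (ennreal (cmod (f x))) ?r \<partial>?\<mu>)"
  proof (rule epowr_nn_integral_le[OF _ _ r])
    have "emeasure ?\<mu> (space ?\<mu>) = emeasure lborel (cell i)"
      by (simp add: emeasure_density)
    then show "emeasure ?\<mu> (space ?\<mu>) \<le> 1" using emeasure_cell_le[of i] by simp
  qed simp
  also have "\<dots> = (\<integral>\<^sup>+x. epowr (indicator (cell i) x * ennreal (cmod (f x))) ?r \<partial>lborel)"
    by (subst nn_integral_density) (auto intro!: nn_integral_cong split: split_indicator)
  finally have "epowr (\<integral>\<^sup>+x. indicator (cell i) x * ennreal (cmod (f x)) \<partial>lborel) ?r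
      \<le> (\<integral>\<^sup>+x. epowr (indicator (cell i) x * ennreal (cmod (f x))) ?r \<partial>lborel)"
    by (simp add: nn_integral_density)
  then have "epowr (epowr (\<integral>\<^sup>+x. indicator (cell i) x * ennreal (cmod (f x)) \<partial>lborel) ?r) (1 / ?r) \<le> cell_norm p f i"
    unfolding cell_norm_def using False by (simp add: Np_def epowr_mono)
  then show ?thesis using r by (simp add: epowr_epowr)
qed

lemma cell_norm_le:
  assumes [measurable]: "f \<in> borel_measurable borel" and p: "1 \<le> p"
    and le: "\<And>x. x \<in> cell i \<Longrightarrow> ennreal (cmod (f x)) \<le> c"
  shows "cell_norm p f i \<le> c"
proof (cases "p = \<infinity>")
  case True
  then show ?thesis
    by (auto simp: cell_norm_def Np_def le intro!: esssup_I split: split_indicator)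
next
  case False
  let ?r = "enn2real p"
  have "(\<integral>\<^sup>+x. epowr (indicator (cell i) x * ennreal (cmod (f x))) ?r \<partial>lborel)
      \<le> (\<integral>\<^sup>+x. epowr c ?r * indicator (cell i) x \<partial>lborel)"
    by (intro nn_integral_mono) (auto simp: le intro!: epowr_mono split: split_indicator)
  also have "\<dots> = epowr c ?r * emeasure lborel (cell i)"
    by (simp add: nn_integral_cmult_indicator)
  also have "\<dots> \<le> epowr c ?r * 1"
    by (intro mult_left_mono emeasure_cell_le) simp
  finally show ?thesis
    unfolding cell_norm_def using p False by (intro Np_leI) simp_all
qed

lemma nn_integral_mult_le_tsum:
  fixes f :: "real ^ 'n \<Rightarrow> complex"
  assumes [measurable]: "f \<in> borel_measurable borel" and p: "1 \<le> p"
    and k: "\<And>y. k y \<le> d (fl y)"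
  shows "(\<integral>\<^sup>+y. k y * ennreal (cmod (f y)) \<partial>lborel) \<le> tsum (\<lambda>j. d j * cell_norm p f j)"
proof -
  have "(\<integral>\<^sup>+y. k y * ennreal (cmod (f y)) \<partial>lborel) \<le> (\<integral>\<^sup>+y. d (fl y) * ennreal (cmod (f y)) \<partial>lborel)"
    by (intro nn_integral_mono mult_right_mono k) simp
  also have "\<dots> = tsum (\<lambda>j. \<integral>\<^sup>+y. indicator (cell j) y * (d (fl y) * ennreal (cmod (f y))) \<partial>lborel)"
    by (rule nn_integral_cells) simp
  also have "\<dots> = tsum (\<lambda>j. \<integral>\<^sup>+y. d j * (indicator (cell j) y * ennreal (cmod (f y))) \<partial>lborel)"
    by (intro nn_integral_cong) (auto simp: cell_def split: split_indicator)
  also have "\<dots> = tsum (\<lambda>j. d j * (\<integral>\<^sup>+y. indicator (cell j) y * ennreal (cmod (f y)) \<partial>lborel))"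
    by (simp add: nn_integral_cmult)
  also have "\<dots> \<le> tsum (\<lambda>j. d j * cell_norm p f j)"
    by (intro nn_integral_mono mult_left_mono nn_integral_cell_le p) auto
  finally show ?thesis .
qed

text \<open>
  The sequence is indexed by the cells of \<open>x - y\<close>, the amalgam norm of the kernel by those of \<open>y - x\<close>.
  This orientation makes the operator act on cell norms by \<open>conv c\<close>.
\<close>

definition dominated :: "((real ^ 'n) \<times> (real ^ 'n) \<Rightarrow> complex) \<Rightarrow> (int ^ 'n \<Rightarrow> ennreal) \<Rightarrow> bool" where
  "dominated K c \<longleftrightarrow> (\<forall>x y. ennreal (cmod (K (x, y))) \<le> c (fl x - fl y))"

section \<open>Kernels dominated by a summable sequence\<close>

lemma nn_integral_kernel_le:
  assumes "f \<in> borel_measurable borel" "1 \<le> p" "\<And>y. ennreal (cmod (k y)) \<le> c (i - fl y)"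
  shows "(\<integral>\<^sup>+y. ennreal (cmod (k y * f y)) \<partial>lborel) \<le> conv c (cell_norm p f) i"
  using nn_integral_mult_le_tsum[of f p "\<lambda>y. ennreal (cmod (k y))" "\<lambda>j. c (i - j)"] assms
  by (simp add: conv_def norm_mult ennreal_mult)

lemma conv_cell_norm_less_top:
  assumes "1 \<le> p" "f \<in> Lp p" "tsum c < top"
  shows "conv c (cell_norm p f) i < top"
proof -
  have "conv c (cell_norm p f) i \<le> tsum c * seq_norm p (cell_norm p f)"
    by (intro conv_le_bound le_seq_norm assms)
  also have "\<dots> < top" using assms by (simp add: Lp_iff ennreal_mult_less_top)
  finally show ?thesis .
qed

lemma kernel_integrable:
  assumes k: "k \<in> borel_measurable borel" "\<And>y. ennreal (cmod (k y)) \<le> c (i - fl y)"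
    and f: "1 \<le> p" "f \<in> Lp p" and c: "tsum c < top"
  shows "integrable lborel (\<lambda>y. k y * f y)"
proof (rule integrableI_bounded)
  show "(\<lambda>y. k y * f y) \<in> borel_measurable lborel"
    using k(1) Lp_measurable[OF f(2)] by measurable
  show "(\<integral>\<^sup>+y. ennreal (norm (k y * f y)) \<partial>lborel) < \<infinity>"
    using nn_integral_kernel_le[OF Lp_measurable[OF f(2)] f(1), of k c i, OF k(2)] conv_cell_norm_less_top[OF f c, of i]
    by (simp add: le_less_trans)
qed

lemma kernel_section_measurable:
  fixes K :: "(real ^ 'n) \<times> (real ^ 'n) \<Rightarrow> complex"
  assumes "K \<in> borel_measurable borel"
  shows "(\<lambda>y. K (x, y)) \<in> borel_measurable borel" "(\<lambda>x. K (x, y)) \<in> borel_measurable borel"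
proof -
  have [measurable]: "K \<in> borel_measurable (borel \<Otimes>\<^sub>M borel)"
    using assms by (simp add: borel_prod)
  show "(\<lambda>y. K (x, y)) \<in> borel_measurable borel" "(\<lambda>x. K (x, y)) \<in> borel_measurable borel"
    by measurable
qed

text \<open>Without integrability the left side is 0, the default value of the integral.\<close>

lemma norm_integral_le_nn: "ennreal (norm (integral\<^sup>L M f)) \<le> (\<integral>\<^sup>+x. ennreal (norm (f x)) \<partial>M)"
  by (cases "integrable M f") (auto simp: integral_norm_bound_ennreal not_integrable_integral_eq)

lemma integral_operator_le:
  assumes "f \<in> borel_measurable borel" "1 \<le> p" "dominated K c"
  shows "ennreal (cmod (integral_operator K f x)) \<le> conv c (cell_norm p f) (fl x)"
  unfolding integral_operator_def
  by (rule order_trans[OF norm_integral_le_nn nn_integral_kernel_le])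
    (use assms in \<open>auto simp: dominated_def\<close>)

lemma measurable_integral_operator [measurable (raw)]:
  assumes [measurable]: "K \<in> borel_measurable borel" "f \<in> borel_measurable borel"
  shows "integral_operator K f \<in> borel_measurable borel"
proof -
  have [measurable]: "K \<in> borel_measurable (borel \<Otimes>\<^sub>M borel)"
    by (simp add: borel_prod)
  have "(\<lambda>x. \<integral>y. K (x, y) * f y \<partial>lborel) \<in> borel_measurable borel"
    by (intro lborel.borel_measurable_lebesgue_integral) measurable
  then show ?thesis by (simp add: integral_operator_def[abs_def])
qed

lemma cell_norm_integral_operator_le:
  assumes "f \<in> borel_measurable borel" "1 \<le> p" "dominated K c" "K \<in> borel_measurable borel"
  shows "cell_norm p (integral_operator K f) i \<le> conv c (cell_norm p f) i"
proof (rule cell_norm_le)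
  fix x assume "x \<in> cell i"
  then show "ennreal (cmod (integral_operator K f x)) \<le> conv c (cell_norm p f) i"
    using integral_operator_le[OF assms(1-3), of x] by (simp add: cell_def)
qed (use assms in \<open>auto intro: measurable_integral_operator\<close>)

lemma integral_operator_Lp:
  assumes p: "1 \<le> p" and f: "f \<in> Lp p" and K: "dominated K c" "K \<in> borel_measurable borel" "tsum c < top"
  shows "integral_operator K f \<in> Lp p"
proof -
  note m = Lp_measurable[OF f]
  have "seq_norm p (cell_norm p (integral_operator K f)) \<le> seq_norm p (conv c (cell_norm p f))"
    by (intro Np_mono p cell_norm_integral_operator_le m K) simp
  also have "\<dots> \<le> tsum c * seq_norm p (cell_norm p f)"
    by (rule seq_norm_conv_le[OF p])
  also have "\<dots> < top" using f K p by (simp add: Lp_iff ennreal_mult_less_top)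
  finally show ?thesis
    using measurable_integral_operator[OF K(2) m] p by (simp add: Lp_iff)
qed

lemma Lp_add:
  assumes "1 \<le> p" "f \<in> Lp p" "g \<in> Lp p" shows "(\<lambda>x. f x + g x) \<in> Lp p"
proof -
  note [measurable] = Lp_measurable[OF assms(2)] Lp_measurable[OF assms(3)]
  have "seq_norm p (cell_norm p (\<lambda>x. f x + g x)) \<le> seq_norm p (\<lambda>i. cell_norm p f i + cell_norm p g i)"
    by (intro Np_mono assms(1) cell_norm_add_le) auto
  also have "\<dots> \<le> seq_norm p (cell_norm p f) + seq_norm p (cell_norm p g)"
    by (rule Np_add_le) (auto simp: assms(1))
  also have "\<dots> < top" using assms by (simp add: Lp_iff)
  finally show ?thesis using assms(1) by (simp add: Lp_iff)
qed

lemma Lp_mult_step: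
  assumes "1 \<le> p" "f \<in> Lp p" "\<And>i. cmod (c i) \<le> B" shows "(\<lambda>x. c (fl x) * f x) \<in> Lp p"
proof -
  note [measurable] = Lp_measurable[OF assms(2)]
  have "seq_norm p (cell_norm p (\<lambda>x. c (fl x) * f x)) \<le> seq_norm p (\<lambda>i. ennreal B * cell_norm p f i)"
    by (intro Np_mono assms(1)) (auto simp: cell_norm_mult_step assms intro!: mult_right_mono ennreal_leI)
  also have "\<dots> \<le> ennreal B * seq_norm p (cell_norm p f)"
    by (rule Np_cmult_le) (auto simp: assms(1))
  also have "\<dots> < top" using assms by (simp add: Lp_iff ennreal_mult_less_top)
  finally show ?thesis using assms(1) by (simp add: Lp_iff)
qed

lemma Lp_cmult: "1 \<le> p \<Longrightarrow> f \<in> Lp p \<Longrightarrow> (\<lambda>x. c * f x) \<in> Lp p"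
  using Lp_mult_step[of p f "\<lambda>_. c" "cmod c"] by simp

text \<open>It turns boundedness of S into off-diagonal decay. Besides linearity, this decay is what
  the construction of the kernel uses of S, until the inverse relations enter at the very
  end.\<close>

theorem inverse_cell_norm_le:
  fixes K :: "(real ^ 'n) \<times> (real ^ 'n) \<Rightarrow> complex"
  assumes p: "1 \<le> p" and K: "dominated K c" "K \<in> borel_measurable borel" "tsum c < top"
    and S: "bounded_inverse_on_Lp p (\<lambda>f x. lam * f x + integral_operator K f x) S"
  obtains W where "tsum W < top" "\<And>g i. g \<in> Lp p \<Longrightarrow> cell_norm p (S g) i \<le> conv W (cell_norm p g) i"
proof -
  define A where "A = (\<lambda>f x. lam * f x + integral_operator K f x)"
  have SL: "S f \<in> Lp p" if "f \<in> Lp p" for f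
    using S that by (auto simp: bounded_inverse_on_Lp_def bounded_operator_on_Lp_def)
  have inv: "AE x in lborel. S (A f) x = f x" "AE x in lborel. A (S f) x = f x" if "f \<in> Lp p" for f
    using S that by (auto simp: bounded_inverse_on_Lp_def A_def)
  have AL: "A f \<in> Lp p" if "f \<in> Lp p" for f
    unfolding A_def by (intro Lp_add Lp_cmult integral_operator_Lp[OF p that K] p that)
  from S obtain C0 where C0: "\<And>f. f \<in> Lp p \<Longrightarrow> Lp_norm p (S f) \<le> C0 * Lp_norm p f"
    unfolding bounded_inverse_on_Lp_def bounded_operator_on_Lp_def by metis
  define C where "C = ennreal \<bar>C0\<bar>"
  have Sbd: "seq_norm p (cell_norm p (S f)) \<le> C * seq_norm p (cell_norm p f)" if f: "f \<in> Lp p" for f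
  proof -
    have nn: "0 \<le> Lp_norm p f" by (simp add: Lp_norm_def)
    have "Lp_norm p (S f) \<le> \<bar>C0\<bar> * Lp_norm p f"
      using C0[OF f] nn by (meson abs_ge_self mult_right_mono order_trans)
    then have "ennreal (Lp_norm p (S f)) \<le> C * ennreal (Lp_norm p f)"
      using nn by (simp add: C_def ennreal_mult[symmetric] ennreal_leI)
    then show ?thesis by (simp add: Lp_norm_eq p f SL)
  qed
  have C: "C < top" by (simp add: C_def)
  show ?thesis
  proof (rule wiener_discrete[OF p K(3) C])
    fix W :: "int ^ 'n \<Rightarrow> ennreal"
    assume W: "tsum W < top"
      "\<And>b b' i. seq_norm p b < top \<Longrightarrow>
         (\<And>\<psi>. (\<And>i. 0 \<le> \<psi> i) \<Longrightarrow> (\<And>i. \<psi> i \<le> 1) \<Longrightarrow>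
            seq_norm p (\<lambda>i. ennreal (\<psi> i) * b i)
              \<le> C * seq_norm p (\<lambda>i. ennreal (\<psi> i) * b' i + commutator_bound c \<psi> b i)) \<Longrightarrow>
         b i \<le> conv W b' i"
    show thesis
    proof (rule that[OF W(1)])
      fix g :: "real ^ 'n \<Rightarrow> complex" and i assume g: "g \<in> Lp p"
      define f where "f = S g"
      have f: "f \<in> Lp p" using SL[OF g] by (simp add: f_def)
      note [measurable] = Lp_measurable[OF f] K(2) Lp_measurable[OF g] Lp_measurable[OF AL]
        measurable_integral_operator
      have "cell_norm p f i \<le> conv W (cell_norm p g) i"
      proof (rule W(2))
        show "seq_norm p (cell_norm p f) < top" using f p by (simp add: Lp_iff)
        fix \<psi> :: "int ^ 'n \<Rightarrow> real" assume \<psi>: "\<And>i. 0 \<le> \<psi> i" "\<And>i. \<psi> i \<le> 1"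
        define h where "h = (\<lambda>x. complex_of_real (\<psi> (fl x)) * f x)"
        have h: "h \<in> Lp p"
          unfolding h_def using \<psi> by (intro Lp_mult_step[where B = 1 and c = "\<lambda>i. complex_of_real (\<psi> i)"] p f) auto
        note [measurable] = Lp_measurable[OF h]
        have "cell_norm p h = (\<lambda>i. ennreal (\<psi> i) * cell_norm p f i)"
          unfolding h_def using \<psi>
          by (intro ext, subst cell_norm_mult_step[where c = "\<lambda>i. complex_of_real (\<psi> i)"]) (auto simp: p)
        then have "seq_norm p (\<lambda>i. ennreal (\<psi> i) * cell_norm p f i) = seq_norm p (cell_norm p h)"
          by simp
        also have "cell_norm p h = cell_norm p (S (A h))"
          by (rule cell_norm_cong_AE[OF _ _ _ p])
            (use inv(1)[OF h] Lp_measurable[OF SL[OF AL[OF h]]] in auto)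
        also have "seq_norm p (cell_norm p (S (A h))) \<le> C * seq_norm p (cell_norm p (A h))"
          by (rule Sbd[OF AL[OF h]])
        also have "\<dots> \<le> C * seq_norm p (\<lambda>i. ennreal (\<psi> i) * cell_norm p g i
            + commutator_bound c \<psi> (cell_norm p f) i)"
        proof (intro mult_left_mono Np_mono p)
          fix i
          \<comment> \<open>The commutator of T with \<psi>, applied to f. The multiple of the
            identity commutes with \<psi> and leaves nothing here.\<close>
          define R where "R x = integral_operator K h x - complex_of_real (\<psi> (fl x)) * integral_operator K f x" for x
          have [measurable]: "R \<in> borel_measurable borel" unfolding R_def by measurable
          have "A h = (\<lambda>x. complex_of_real (\<psi> (fl x)) * A f x + R x)"
            by (simp add: A_def R_def h_def fun_eq_iff algebra_simps)
          then have "cell_norm p (A h) i \<le> cell_norm p (\<lambda>x. complex_of_real (\<psi> (fl x)) * A f x) i + cell_norm p R i"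
            using f by (simp add: cell_norm_add_le p)
          also have "cell_norm p (\<lambda>x. complex_of_real (\<psi> (fl x)) * A f x) i = ennreal (\<psi> i) * cell_norm p (A f) i"
            using \<psi> f by (subst cell_norm_mult_step[where c = "\<lambda>i. complex_of_real (\<psi> i)"]) (auto simp: p)
          also have "cell_norm p (A f) = cell_norm p g"
            using inv(2)[OF g] by (intro cell_norm_cong_AE p) (auto simp: f_def[symmetric] f)
          also have "cell_norm p R i \<le> commutator_bound c \<psi> (cell_norm p f) i"
          proof (rule cell_norm_le)
            fix x assume x: "x \<in> cell i"
            have d: "ennreal (cmod (K (x, y))) \<le> c (i - fl y)" for y
              using K(1) x by (auto simp: dominated_def cell_def)
            have int: "integrable lborel (\<lambda>y. K (x, y) * u y)" if "u \<in> Lp p" for u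
              by (rule kernel_integrable[OF kernel_section_measurable(1)[OF K(2)] d p that K(3)])
            have "R x = (\<integral>y. K (x, y) * h y - complex_of_real (\<psi> i) * (K (x, y) * f y) \<partial>lborel)"
              using x int[OF f] int[OF h] by (simp add: R_def integral_operator_def cell_def)
            also have "\<dots> = (\<integral>y. (K (x, y) * (complex_of_real (\<psi> (fl y)) - complex_of_real (\<psi> i))) * f y \<partial>lborel)"
              by (simp add: h_def algebra_simps)
            finally have "ennreal (cmod (R x)) \<le> (\<integral>\<^sup>+y. ennreal (cmod (K (x, y) * (complex_of_real (\<psi> (fl y)) - complex_of_real (\<psi> i)) * f y)) \<partial>lborel)"
              by (simp add: norm_integral_le_nn)
            also have "\<dots> = (\<integral>\<^sup>+y. ennreal (cmod (K (x, y))) * ennreal \<bar>\<psi> i - \<psi> (fl y)\<bar> * ennreal (cmod (f y)) \<partial>lborel)"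
              by (simp add: norm_mult ennreal_mult abs_minus_commute flip: of_real_diff)
            also have "\<dots> \<le> tsum (\<lambda>j. c (i - j) * ennreal \<bar>\<psi> i - \<psi> j\<bar> * cell_norm p f j)"
              by (rule nn_integral_mult_le_tsum) (auto simp: p intro!: mult_right_mono d)
            finally show "ennreal (cmod (R x)) \<le> commutator_bound c \<psi> (cell_norm p f) i"
              by (simp add: commutator_bound_def)
          qed (auto simp: p)
          finally show "cell_norm p (A h) i \<le> ennreal (\<psi> i) * cell_norm p g i + commutator_bound c \<psi> (cell_norm p f) i"
            by (simp add: add_left_mono)
        qed auto
        finally show "seq_norm p (\<lambda>i. ennreal (\<psi> i) * cell_norm p f i)
            \<le> C * seq_norm p (\<lambda>i. ennreal (\<psi> i) * cell_norm p g i + commutator_bound c \<psi> (cell_norm p f) i)" .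
      qed
      then show "cell_norm p (S g) i \<le> conv W (cell_norm p g) i" by (simp add: f_def)
    qed
  qed
qed

section \<open>Amalgam norms and dominating sequences\<close>

text \<open>Both sides are suprema of finite sums; the type is exhausted by the finite sets of
  elements with bounded \<open>to_nat\<close>.\<close>

lemma infsum_eq_tsum:
  fixes f :: "'g::countable \<Rightarrow> ennreal"
  shows "infsum f UNIV = tsum f"
proof -
  have "infsum f UNIV = (SUP F\<in>{F. finite F}. sum f F)"
    using nonneg_infsum_complete[of UNIV f] by simp
  also have "\<dots> = tsum f"
  proof (rule antisym)
    show "(SUP F\<in>{F. finite F}. sum f F) \<le> tsum f"
    proof (rule SUP_least)
      fix F :: "'g set" assume "F \<in> {F. finite F}"
      then have "sum f F = tsum (\<lambda>x. f x * indicator F x)"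
        by (simp add: nn_integral_indicator_finite)
      also have "\<dots> \<le> tsum f"
        by (intro nn_integral_mono) (auto split: split_indicator)
      finally show "sum f F \<le> tsum f" .
    qed
    define A where "A n = {x :: 'g. to_nat x < n}" for n
    have finA: "finite (A n)" for n
      unfolding A_def by (rule finite_subset[OF _ finite_vimageI[OF finite_lessThan inj_to_nat]]) auto
    have "f x = (SUP n. f x * indicator (A n) x)" for x
    proof (rule antisym)
      show "f x \<le> (SUP n. f x * indicator (A n) x)"
        by (rule SUP_upper2[of "Suc (to_nat x)"]) (auto simp: A_def)
      show "(SUP n. f x * indicator (A n) x) \<le> f x"
        by (rule SUP_least) (auto split: split_indicator)
    qed
    then have "tsum f = tsum (\<lambda>x. SUP n. f x * indicator (A n) x)"
      by (intro nn_integral_cong)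
    also have "\<dots> = (SUP n. tsum (\<lambda>x. f x * indicator (A n) x))"
      by (rule nn_integral_monotone_convergence_SUP)
        (auto simp: incseq_def le_fun_def A_def split: split_indicator)
    also have "\<dots> = (SUP n. sum f (A n))"
      by (simp add: nn_integral_indicator_finite finA)
    also have "\<dots> \<le> (SUP F\<in>{F. finite F}. sum f F)"
      by (rule SUP_least) (auto intro!: SUP_upper finA)
    finally show "tsum f \<le> (SUP F\<in>{F. finite F}. sum f F)" .
  qed
  finally show ?thesis .
qed

text \<open>
  The radius \<open>3\<close> covers the difference between the cell of \<open>y - x\<close> and the difference of the cells of
  \<open>y\<close> and \<open>x\<close>, also after moving \<open>y - x\<close> by at most \<open>2\<close> in each coordinate.
\<close>

definition spread :: "(int ^ 'n \<Rightarrow> ennreal) \<Rightarrow> int ^ 'n \<Rightarrow> ennreal" where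
  "spread s m = tsum (\<lambda>e. indicator {e. supn e \<le> 3} e * s (e - m))"

text \<open>The number of lattice points with \<open>supn e \<le> 3\<close>, as 7 = 2 * 3 +
  1.\<close>

abbreviation spread_const :: "'n itself \<Rightarrow> ennreal" where
  "spread_const _ \<equiv> of_nat (7 ^ CARD('n))"

lemma tsum_spread:
  fixes s :: "int ^ 'n \<Rightarrow> ennreal"
  shows "tsum (spread s) = spread_const TYPE('n) * tsum s"
proof -
  have "tsum (spread s) = tsum (\<lambda>e. indicator {e. supn e \<le> 3} e * tsum (\<lambda>m. s (e - m)))"
    unfolding spread_def by (subst tsum_swap) (simp add: nn_integral_cmult)
  also have "\<dots> = tsum (\<lambda>e. tsum s * indicator {e :: int ^ 'n. supn e \<le> int 3} e)"
    by (simp add: tsum_reflect mult.commute)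
  also have "\<dots> = tsum s * of_nat (card {e :: int ^ 'n. supn e \<le> int 3})"
    using finite_supn_ball[of 3, where 'n = 'n] by (subst nn_integral_cmult_indicator) auto
  also have "card {e :: int ^ 'n. supn e \<le> int 3} = 7 ^ CARD('n)"
    unfolding card_supn_ball by simp
  finally show ?thesis by (simp add: mult.commute)
qed

lemma le_spread: "supn (k + m) \<le> 3 \<Longrightarrow> s k \<le> spread s m"
  unfolding spread_def
  by (rule order_trans[OF _ le_tsum[of _ "k + m"]]) simp

abbreviation vec_of_int :: "int ^ 'n \<Rightarrow> real ^ 'n" where
  "vec_of_int k \<equiv> (\<chi> i. real_of_int (k $ i))"

text \<open>The three floor errors add up to a value in (-2, 1) and the displacement is at most 2,
  so the integer lies in (-4, 3).\<close>

lemma floor_near: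
  fixes x y x' y' :: real
  assumes "\<bar>(y - x) - (y' - x')\<bar> \<le> 2"
  shows "\<bar>\<lfloor>y - x\<rfloor> + (\<lfloor>x'\<rfloor> - \<lfloor>y'\<rfloor>)\<bar> \<le> 3"
  using assms by linarith

text \<open>F is arbitrary in order to serve both the absolute value of K and its modulus of
  continuity. The slack of 2 between (x, y) and (x', y') lets a shifted column be bounded by the
  sequence at the unshifted cell.\<close>

lemma wiener_dominates:
  fixes F :: "(real ^ 'n) \<times> (real ^ 'n) \<Rightarrow> ennreal"
  obtains c where
    "tsum c = spread_const TYPE('n) * wiener_amalgam_norm (\<lambda>x. SUP y. F (y, x + y))"
    "\<And>x y x' y'. (\<And>i. \<bar>((y - x) - (y' - x')) $ i\<bar> \<le> 2) \<Longrightarrow> F (x, y) \<le> c (fl x' - fl y')"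
proof
  define s where "s = (\<lambda>k :: int ^ 'n. SUP x\<in>{x. \<forall>i. 0 \<le> x $ i \<and> x $ i < 1}.
    SUP y. F (y, (vec_of_int k + x) + y))"
  show "tsum (spread s) = spread_const TYPE('n) * wiener_amalgam_norm (\<lambda>x. SUP y. F (y, x + y))"
    unfolding wiener_amalgam_norm_def infsum_eq_tsum by (simp add: tsum_spread s_def)
  fix x y x' y' :: "real ^ 'n"
  assume near: "\<And>i. \<bar>((y - x) - (y' - x')) $ i\<bar> \<le> 2"
  define z where "z = y - x - vec_of_int (fl (y - x))"
  have z: "z \<in> {x. \<forall>i. 0 \<le> x $ i \<and> x $ i < 1}"
    by (auto simp: z_def) linarith+
  have "F (x, y) = F (x, (vec_of_int (fl (y - x)) + z) + x)"
    by (simp add: z_def)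
  also have "\<dots> \<le> s (fl (y - x))"
    unfolding s_def by (intro SUP_upper2[OF z] SUP_upper) simp
  also have "\<dots> \<le> spread s (fl x' - fl y')"
    by (intro le_spread) (use near floor_near in \<open>simp add: supn_le_iff\<close>)
  finally show "F (x, y) \<le> spread s (fl x' - fl y')" .
qed

text \<open>The way back from sequences: the difference of the cells of y and k + x + y is within 3
  of - k, and \<open>spread\<close> sums over all candidates.\<close>

lemma wiener_le:
  fixes F :: "(real ^ 'n) \<times> (real ^ 'n) \<Rightarrow> ennreal"
  assumes F: "\<And>x y. F (x, y) \<le> c (fl x - fl y)"
  shows "wiener_amalgam_norm (\<lambda>x. SUP y. F (y, x + y)) \<le> spread_const TYPE('n) * tsum c"
proof -
  have "wiener_amalgam_norm (\<lambda>x. SUP y. F (y, x + y)) \<le> tsum (spread c)"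
    unfolding wiener_amalgam_norm_def infsum_eq_tsum
  proof (intro nn_integral_mono SUP_least)
    fix k :: "int ^ 'n" and x y :: "real ^ 'n"
    assume x: "x \<in> {x. \<forall>i. 0 \<le> x $ i \<and> x $ i < 1}"
    have "F (y, vec_of_int k + x + y) \<le> c (fl y - fl (vec_of_int k + x + y))"
      by (rule F)
    also have "\<dots> \<le> spread c k"
    proof (rule le_spread, unfold supn_le_iff, intro allI)
      fix i
      have "0 \<le> x $ i" "x $ i < 1" using x by auto
      then have "\<bar>\<lfloor>y $ i\<rfloor> - \<lfloor>of_int (k $ i) + x $ i + y $ i\<rfloor> + k $ i\<bar> \<le> 3"
        by linarith
      then show "\<bar>(fl y - fl (vec_of_int k + x + y) + k) $ i\<bar> \<le> 3" by simp
    qed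
    finally show "F (y, vec_of_int k + x + y) \<le> spread c k" .
  qed
  then show ?thesis by (simp add: tsum_spread)
qed

text \<open>The sequence may vary with \<delta> in any way; only its sum is controlled, as in the
  amalgam bound.\<close>

definition holder_dominated ::
    "real \<Rightarrow> real \<Rightarrow> ((real ^ 'n) \<times> (real ^ 'n) \<Rightarrow> complex) \<Rightarrow> bool" where
  "holder_dominated \<alpha> M K \<longleftrightarrow> (\<forall>\<delta>. 0 < \<delta> \<and> \<delta> < 1 \<longrightarrow>
     (\<exists>w. tsum w \<le> ennreal (M * \<delta> powr \<alpha>) \<and> (\<forall>x y. modulus_of_continuity \<delta> K (x, y) \<le> w (fl x - fl y))))"

lemma modulus_ge: "norm h \<le> \<delta> \<Longrightarrow> ennreal (cmod (K (z + h) - K z)) \<le> modulus_of_continuity \<delta> K z"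
  unfolding modulus_of_continuity_def by (rule SUP_upper) simp

lemma amalgam_imp_dominated:
  fixes K :: "(real ^ 'n) \<times> (real ^ 'n) \<Rightarrow> complex"
  assumes "amalgam_kernel_bounds \<alpha> D K" "0 < D"
  obtains c where "tsum c < top"
    "\<And>x y x' y'. (\<And>i. \<bar>((y - x) - (y' - x')) $ i\<bar> \<le> 2) \<Longrightarrow> ennreal (cmod (K (x, y))) \<le> c (fl x' - fl y')"
    "holder_dominated \<alpha> (7 ^ CARD('n) * D) K"
proof -
  let ?P = "spread_const TYPE('n)"
  obtain c where c: "tsum c = ?P * wiener_amalgam_norm (\<lambda>x. SUP y. ennreal (cmod (K (y, x + y))))"
    "\<And>x y x' y'. (\<And>i. \<bar>((y - x) - (y' - x')) $ i\<bar> \<le> 2) \<Longrightarrow> ennreal (cmod (K (x, y))) \<le> c (fl x' - fl y')"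
    using wiener_dominates[of "\<lambda>z. ennreal (cmod (K z))"] by blast
  have "tsum c \<le> ?P * ennreal D"
    unfolding c(1) using assms(1) by (intro mult_left_mono) (auto simp: amalgam_kernel_bounds_def)
  also have "\<dots> < top" by (simp add: ennreal_mult_less_top of_nat_less_top power_less_top_ennreal)
  finally have "tsum c < top" .
  moreover have "holder_dominated \<alpha> (7 ^ CARD('n) * D) K"
    unfolding holder_dominated_def
  proof (intro allI impI)
    fix \<delta> :: real assume \<delta>: "0 < \<delta> \<and> \<delta> < 1"
    obtain w where w: "tsum w = ?P * wiener_amalgam_norm (\<lambda>x. SUP y. modulus_of_continuity \<delta> K (y, x + y))"
      "\<And>x y x' y'. (\<And>i. \<bar>((y - x) - (y' - x')) $ i\<bar> \<le> 2) \<Longrightarrow> modulus_of_continuity \<delta> K (x, y) \<le> w (fl x' - fl y')"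
      using wiener_dominates[of "modulus_of_continuity \<delta> K"] by blast
    have "tsum w \<le> ?P * ennreal (D * \<delta> powr \<alpha>)"
      unfolding w(1) using assms(1) \<delta> by (intro mult_left_mono) (auto simp: amalgam_kernel_bounds_def)
    also have "\<dots> = ennreal (7 ^ CARD('n) * D * \<delta> powr \<alpha>)"
      using assms(2) by (simp add: ennreal_mult ennreal_of_nat_eq_real_of_nat ennreal_power[symmetric] mult.assoc)
    finally show "\<exists>w. tsum w \<le> ennreal (7 ^ CARD('n) * D * \<delta> powr \<alpha>)
        \<and> (\<forall>x y. modulus_of_continuity \<delta> K (x, y) \<le> w (fl x - fl y))"
      using w(2) by (intro exI[of _ w]) auto
  qed
  ultimately show ?thesis using c(2) by (intro that[of c]) auto
qed

lemma dominated_imp_amalgam: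
  fixes K :: "(real ^ 'n) \<times> (real ^ 'n) \<Rightarrow> complex"
  assumes c: "dominated K c" "tsum c < top" and M: "holder_dominated \<alpha> M K" "0 \<le> M"
  obtains D where "0 < D" "amalgam_kernel_bounds \<alpha> D K"
proof -
  let ?P = "spread_const TYPE('n)"
  \<comment> \<open>The summand 1 makes D positive even if the other two vanish.\<close>
  define D where "D = 7 ^ CARD('n) * enn2real (tsum c) + 7 ^ CARD('n) * M + 1"
  have P: "?P = ennreal (7 ^ CARD('n))" by (simp add: ennreal_of_nat_eq_real_of_nat)
  have D: "0 < D" using M(2) by (auto simp: D_def intro!: add_nonneg_pos add_nonneg_nonneg)
  moreover have "wiener_amalgam_norm (\<lambda>x. SUP y. ennreal (cmod (K (y, x + y)))) \<le> ennreal D"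
  proof -
    have "wiener_amalgam_norm (\<lambda>x. SUP y. ennreal (cmod (K (y, x + y)))) \<le> ?P * tsum c"
      using c(1) by (intro wiener_le) (auto simp: dominated_def)
    also have "\<dots> = ennreal (7 ^ CARD('n) * enn2real (tsum c))"
      using c(2) unfolding P by (simp add: ennreal_mult)
    also have "\<dots> \<le> ennreal D" using M(2) by (auto simp: D_def intro!: ennreal_leI)
    finally show ?thesis .
  qed
  moreover have "wiener_amalgam_norm (\<lambda>x. SUP y. modulus_of_continuity \<delta> K (y, x + y)) \<le> ennreal (D * \<delta> powr \<alpha>)"
    if \<delta>: "0 < \<delta>" "\<delta> < 1" for \<delta>
  proof -
    obtain w where w: "tsum w \<le> ennreal (M * \<delta> powr \<alpha>)"
      "\<And>x y. modulus_of_continuity \<delta> K (x, y) \<le> w (fl x - fl y)"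
      using M(1) \<delta> by (auto simp: holder_dominated_def)
    have "wiener_amalgam_norm (\<lambda>x. SUP y. modulus_of_continuity \<delta> K (y, x + y)) \<le> ?P * tsum w"
      by (intro wiener_le w)
    also have "\<dots> \<le> ?P * ennreal (M * \<delta> powr \<alpha>)" by (intro mult_left_mono w) simp
    also have "\<dots> = ennreal (7 ^ CARD('n) * M * \<delta> powr \<alpha>)"
      using M(2) unfolding P by (simp add: ennreal_mult mult.assoc)
    also have "\<dots> \<le> ennreal (D * \<delta> powr \<alpha>)"
      by (intro ennreal_leI mult_right_mono) (auto simp: D_def)
    finally show ?thesis .
  qed
  ultimately show ?thesis
    by (intro that[of D]) (auto simp: amalgam_kernel_bounds_def)
qed

text \<open>One term of \<open>w\<close> is at most its sum, so the modulus is uniformly small.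
  Measurability of K, and later of \<open>K2\<close>, comes from here; for \<open>K2\<close> it
  could not be read off from the definition through S.\<close>

lemma holder_dominated_continuous:
  fixes K :: "(real ^ 'n) \<times> (real ^ 'n) \<Rightarrow> complex"
  assumes K: "holder_dominated \<alpha> M K" and \<alpha>: "0 < \<alpha>" and M: "0 \<le> M"
  shows "continuous_on UNIV K"
proof -
  have bd: "cmod (K (z + h) - K z) \<le> M * \<delta> powr \<alpha>" if \<delta>: "0 < \<delta>" "\<delta> < 1" "norm h \<le> \<delta>" for z h \<delta>
  proof -
    obtain w where w: "tsum w \<le> ennreal (M * \<delta> powr \<alpha>)"
      "\<And>x y. modulus_of_continuity \<delta> K (x, y) \<le> w (fl x - fl y)"
      using K \<delta> by (auto simp: holder_dominated_def)
    have "ennreal (cmod (K (z + h) - K z)) \<le> modulus_of_continuity \<delta> K z"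
      by (rule modulus_ge[OF \<delta>(3)])
    also have "\<dots> \<le> w (fl (fst z) - fl (snd z))" using w(2)[of "fst z" "snd z"] by simp
    also have "\<dots> \<le> tsum w" by (rule le_tsum)
    also note w(1)
    finally show ?thesis using M by simp
  qed
  have "isCont K z" for z
    unfolding isCont_def
  proof (rule LIM_offset_zero_cancel, rule LIM_I)
    fix r :: real assume "0 < r"
    have "((\<lambda>\<delta>. M * \<delta> powr \<alpha>) \<longlongrightarrow> M * 0) (at_right 0)"
      by (intro tendsto_mult tendsto_const) (use \<alpha> in real_asymp)
    then have "eventually (\<lambda>\<delta>. M * \<delta> powr \<alpha> < r) (at_right 0)"
      using \<open>0 < r\<close> by (intro order_tendstoD(2)) auto
    moreover have "eventually (\<lambda>\<delta>::real. 0 < \<delta> \<and> \<delta> < 1) (at_right 0)"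
      by (simp add: eventually_at_right_field) (use zero_less_one in blast)
    ultimately have "eventually (\<lambda>\<delta>. M * \<delta> powr \<alpha> < r \<and> 0 < \<delta> \<and> \<delta> < 1) (at_right 0)"
      by eventually_elim auto
    then obtain \<delta> where \<delta>: "M * \<delta> powr \<alpha> < r" "0 < \<delta>" "\<delta> < 1"
      using eventually_happens'[of "at_right (0::real)"] by (auto simp: trivial_limit_at_right_real)
    show "\<exists>s>0. \<forall>x. x \<noteq> 0 \<and> norm (x - 0) < s \<longrightarrow> norm (K (z + x) - K z) < r"
    proof (intro exI[of _ \<delta>] conjI allI impI \<delta>(2))
      fix h :: "(real ^ 'n) \<times> (real ^ 'n)" assume "h \<noteq> 0 \<and> norm (h - 0) < \<delta>"
      then have "cmod (K (z + h) - K z) \<le> M * \<delta> powr \<alpha>"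
        by (intro bd[OF \<delta>(2,3)]) simp
      then show "norm (K (z + h) - K z) < r" using \<delta>(1) by simp
    qed
  qed
  then show ?thesis by (simp add: continuous_at_imp_continuous_on)
qed

lemma conv_shift: "conv a (\<lambda>i. b (i - l)) k = conv a b (k - l)"
proof -
  have "conv a b (k - l) = tsum (\<lambda>j. a (k - l - (j - l)) * b (j - l))"
    unfolding conv_def by (rule tsum_shift[symmetric])
  then show ?thesis by (simp add: conv_def)
qed

section \<open>Riemann sums\<close>

text \<open>The lower corner of the cube of side 1 / n that contains y; for 0 < n these cubes
  subdivide the unit cells.\<close>

definition grid :: "nat \<Rightarrow> real ^ 'n \<Rightarrow> real ^ 'n" where
  "grid n y = (1 / real n) *\<^sub>R vec_of_int (fl (real n *\<^sub>R y))"

text \<open>The indicator of one such cube, cut off outside the unit cells of norm at most n so that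
  finitely many points carry the sum.\<close>

definition grid_weight :: "nat \<Rightarrow> real ^ 'n \<Rightarrow> real ^ 'n \<Rightarrow> complex" where
  "grid_weight n v y = indicator {v} (grid n y) * indicator {j. supn j \<le> int n} (fl y)"

definition grid_points :: "nat \<Rightarrow> (real ^ 'n) set" where
  "grid_points n = grid n ` {y. supn (fl y) \<le> int n}"

lemma measurable_grid_weight [measurable]: "grid_weight n v \<in> borel_measurable borel"
proof -
  have m [measurable]: "(\<lambda>y :: real ^ 'n. fl (real n *\<^sub>R y)) \<in> borel \<rightarrow>\<^sub>M count_space UNIV"
    by (rule measurable_compose[OF _ measurable_fl]) measurable
  have "(\<lambda>y. indicator {v} ((1 / real n) *\<^sub>R vec_of_int (fl (real n *\<^sub>R y))) :: complex) \<in> borel_measurable borel"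
    by (rule measurable_compose[OF m]) simp
  moreover have "(\<lambda>y :: real ^ 'a. indicator {j. supn j \<le> int n} (fl y) :: complex) \<in> borel_measurable borel"
    by (rule measurable_compose[OF measurable_fl]) simp
  ultimately show ?thesis
    unfolding grid_weight_def[abs_def] grid_def by (rule borel_measurable_times)
qed

lemma finite_grid_points: "finite (grid_points n :: (real ^ 'n) set)"
proof -
  \<comment> \<open>Coordinates with floor in [- n, n] lie in [- n, n + 1); multiplied by n they
    stay within n (n + 1).\<close>
  have "grid_points n \<subseteq> (\<lambda>k. (1 / real n) *\<^sub>R vec_of_int k) ` {k :: int ^ 'n. supn k \<le> int (n * (n + 1))}"
  proof
    fix v :: "real ^ 'n" assume "v \<in> grid_points n"
    then obtain y :: "real ^ 'n" where y: "supn (fl y) \<le> int n" "v = grid n y"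
      by (auto simp: grid_points_def)
    have "supn (fl (real n *\<^sub>R y)) \<le> int (n * (n + 1))"
      unfolding supn_le_iff
    proof
      fix i
      have "\<bar>\<lfloor>y $ i\<rfloor>\<bar> \<le> int n" using abs_le_supn[of "fl y" i] y(1) by simp
      then have "- real n \<le> y $ i" "y $ i \<le> real n + 1" by linarith+
      then have "real n * - real n \<le> real n * y $ i" "real n * y $ i \<le> real n * (real n + 1)"
        by (intro mult_left_mono; simp)+
      moreover have "real n * - real n \<ge> - (real n * (real n + 1))" by (simp add: algebra_simps)
      ultimately have "- real_of_int (int (n * (n + 1))) \<le> real n * y $ i"
        "real n * y $ i \<le> real_of_int (int (n * (n + 1)))"
        by (simp_all add: algebra_simps)
      then have "- int (n * (n + 1)) \<le> \<lfloor>real n * y $ i\<rfloor>" "\<lfloor>real n * y $ i\<rfloor> \<le> int (n * (n + 1))"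
        by (simp_all add: le_floor_iff floor_le_iff del: of_nat_mult of_int_of_nat_eq)
      then show "\<bar>fl (real n *\<^sub>R y) $ i\<bar> \<le> int (n * (n + 1))"
        by (simp add: abs_le_iff del: of_nat_mult)
    qed
    then show "v \<in> (\<lambda>k. (1 / real n) *\<^sub>R vec_of_int k) ` {k :: int ^ 'n. supn k \<le> int (n * (n + 1))}"
      unfolding y(2) grid_def by blast
  qed
  then show ?thesis by (rule finite_subset) (intro finite_imageI finite_supn_ball)
qed

lemma norm_grid_diff:
  fixes y :: "real ^ 'n"
  assumes "0 < n"
  shows "norm (grid n y - y) \<le> real CARD('n) / real n"
proof -
  have "norm (grid n y - y) \<le> (\<Sum>i\<in>UNIV. \<bar>(grid n y - y) $ i\<bar>)"
    by (rule norm_le_l1_cart)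
  also have "\<dots> \<le> (\<Sum>i\<in>(UNIV :: 'n set). 1 / real n)"
  proof (rule sum_mono)
    fix i :: 'n
    have "(grid n y - y) $ i = (real_of_int \<lfloor>real n * y $ i\<rfloor> - real n * y $ i) / real n"
      using assms by (simp add: grid_def field_simps)
    moreover have "\<bar>real_of_int \<lfloor>real n * y $ i\<rfloor> - real n * y $ i\<bar> \<le> 1" by linarith
    ultimately show "\<bar>(grid n y - y) $ i\<bar> \<le> 1 / real n"
      using assms by (simp add: divide_right_mono)
  qed
  also have "\<dots> = real CARD('n) / real n" by simp
  finally show ?thesis .
qed

lemma sum_grid_weight:
  "(\<Sum>v\<in>grid_points n. grid_weight n v y * g v) = (if supn (fl y) \<le> int n then g (grid n y) else 0)"
proof (cases "supn (fl y) \<le> int n")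
  case True
  then have "(\<Sum>v\<in>grid_points n. grid_weight n v y * g v) = (\<Sum>v\<in>{grid n y}. grid_weight n v y * g v)"
    by (intro sum.mono_neutral_right finite_grid_points) (auto simp: grid_points_def grid_weight_def)
  then show ?thesis using True by (simp add: grid_weight_def)
qed (simp add: grid_weight_def)

lemma integrable_grid_weight:
  assumes "1 \<le> p" "f \<in> Lp p"
  shows "integrable lborel (\<lambda>y. grid_weight n v y * f y)"
proof (rule kernel_integrable[where c = "indicator {j. supn j \<le> int n}" and i = 0, OF _ _ assms])
  show "ennreal (cmod (grid_weight n v y)) \<le> indicator {j. supn j \<le> int n} (0 - fl y)" for y
    by (auto simp: grid_weight_def norm_mult supn_minus split: split_indicator)
  show "tsum (indicator {j. supn j \<le> int n} :: int ^ 'a \<Rightarrow> ennreal) < top"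
    using finite_supn_ball[of n, where 'n = 'a] by (simp add: of_nat_less_top)
qed simp

text \<open>It does not depend on x, so the Riemann sum of \<open>integral_operator K f\<close> is a
  finite linear combination of columns of K, to which S applies termwise.\<close>

definition grid_coeff :: "nat \<Rightarrow> (real ^ 'n \<Rightarrow> complex) \<Rightarrow> real ^ 'n \<Rightarrow> complex" where
  "grid_coeff n f v = (\<integral>y. grid_weight n v y * f y \<partial>lborel)"

text \<open>Inside the box, replacing y by its grid point costs the modulus \<open>w\<close>;
  outside, where the sum has no terms, the full kernel bound \<open>c\<close> is paid.\<close>

definition riemann_error ::
    "(int ^ 'n \<Rightarrow> ennreal) \<Rightarrow> (int ^ 'n \<Rightarrow> ennreal) \<Rightarrow> nat \<Rightarrow> (int ^ 'n \<Rightarrow> ennreal) \<Rightarrow> int ^ 'n \<Rightarrow> ennreal" where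
  "riemann_error w c n b i = conv w b i + conv c (\<lambda>j. b j * indicator {j. int n < supn j} j) i"

text \<open>Applied both to K and to the kernel of T S T. The coefficients are the same, so T S maps
  one Riemann sum to the other.\<close>

lemma riemann_sum_error:
  fixes K :: "(real ^ 'n) \<times> (real ^ 'n) \<Rightarrow> complex"
  assumes p: "1 \<le> p" and f: "f \<in> Lp p" and K: "dominated K c" "tsum c < top" "K \<in> borel_measurable borel"
    and n: "0 < n" "real CARD('n) / real n \<le> \<delta>"
    and w: "\<And>x y. modulus_of_continuity \<delta> K (x, y) \<le> w (fl x - fl y)"
  shows "ennreal (cmod (integral_operator K f x - (\<Sum>v\<in>grid_points n. grid_coeff n f v * K (x, v))))
    \<le> riemann_error w c n (cell_norm p f) (fl x)"
proof -
  let ?b = "cell_norm p f" and ?i = "fl x"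
  define k where "k y = K (x, y) - (\<Sum>v\<in>grid_points n. grid_weight n v y * K (x, v))" for y
  define d where "d j = (if supn j \<le> int n then w (?i - j) else c (?i - j))" for j
  have int: "integrable lborel (\<lambda>y. K (x, y) * f y)"
    by (rule kernel_integrable[OF kernel_section_measurable(1)[OF K(3)] _ p f K(2)])
      (use K(1) in \<open>auto simp: dominated_def\<close>)
  have "integral_operator K f x - (\<Sum>v\<in>grid_points n. grid_coeff n f v * K (x, v))
      = (\<integral>y. K (x, y) * f y - (\<Sum>v\<in>grid_points n. (grid_weight n v y * f y) * K (x, v)) \<partial>lborel)"
    by (subst Bochner_Integration.integral_diff)
      (auto simp: int integral_operator_def grid_coeff_def integrable_grid_weight[OF p f])
  also have "\<dots> = (\<integral>y. k y * f y \<partial>lborel)"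
    by (intro Bochner_Integration.integral_cong refl) (simp add: k_def algebra_simps sum_distrib_left)
  finally have "ennreal (cmod (integral_operator K f x - (\<Sum>v\<in>grid_points n. grid_coeff n f v * K (x, v))))
      \<le> (\<integral>\<^sup>+y. ennreal (cmod (k y * f y)) \<partial>lborel)"
    by (simp only: norm_integral_le_nn)
  also have "\<dots> = (\<integral>\<^sup>+y. ennreal (cmod (k y)) * ennreal (cmod (f y)) \<partial>lborel)"
    by (simp add: norm_mult ennreal_mult)
  also have "\<dots> \<le> tsum (\<lambda>j. d j * ?b j)"
  proof (rule nn_integral_mult_le_tsum[OF Lp_measurable[OF f] p])
    fix y
    show "ennreal (cmod (k y)) \<le> d (fl y)"
    proof (cases "supn (fl y) \<le> int n")
      case True
      have "ennreal (cmod (k y)) = ennreal (cmod (K ((x, y) + (0, grid n y - y)) - K (x, y)))"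
        using True by (simp add: k_def sum_grid_weight norm_minus_commute)
      also have "\<dots> \<le> modulus_of_continuity \<delta> K (x, y)"
        by (rule modulus_ge) (use norm_grid_diff[OF n(1), of y] n(2) in \<open>simp add: norm_Pair\<close>)
      also have "\<dots> \<le> d (fl y)" using True w by (simp add: d_def)
      finally show ?thesis .
    next
      case False
      then show ?thesis using K(1) by (simp add: k_def sum_grid_weight d_def dominated_def)
    qed
  qed
  also have "\<dots> \<le> tsum (\<lambda>j. w (?i - j) * ?b j + c (?i - j) * (?b j * indicator {j. int n < supn j} j))"
    by (intro nn_integral_mono) (auto simp: d_def)
  also have "\<dots> = riemann_error w c n ?b ?i"
    by (simp add: riemann_error_def conv_def nn_integral_add)
  finally show ?thesis .
qed

text \<open>The sequence \<open>b\<close> is only bounded, so its tail need not be small in norm.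
  Against the summable \<open>conv A c\<close> it tends to 0 at each i by dominated
  convergence.\<close>

lemma riemann_error_tendsto_0:
  fixes A b c :: "int ^ 'n \<Rightarrow> ennreal"
  assumes A: "tsum A < top" and c: "tsum c < top" and b: "\<And>j. b j \<le> B" "B < top"
    and w: "(\<lambda>n. tsum (w n)) \<longlonglongrightarrow> 0"
  shows "(\<lambda>n. conv A (riemann_error (w n) c n b) i) \<longlonglongrightarrow> 0"
proof -
  let ?t = "\<lambda>n j. b j * indicator {j. int n < supn j} j"
  have eq: "conv A (riemann_error (w n) c n b) i = conv A (conv (w n) b) i + conv (conv A c) (?t n) i" for n
    unfolding riemann_error_def by (simp add: conv_add_right conv_assoc)
  have "(\<lambda>n. conv A (conv (w n) b) i) \<longlonglongrightarrow> 0"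
  proof (rule tendsto_sandwich[OF _ _ tendsto_const])
    show "eventually (\<lambda>n. conv A (conv (w n) b) i \<le> (tsum A * B) * tsum (w n)) sequentially"
    proof (rule always_eventually, rule allI)
      fix n
      have "conv A (conv (w n) b) i \<le> tsum A * (tsum (w n) * B)"
        by (intro conv_le_bound b)
      then show "conv A (conv (w n) b) i \<le> (tsum A * B) * tsum (w n)" by (simp add: mult_ac)
    qed
    have "(\<lambda>n. (tsum A * B) * tsum (w n)) \<longlonglongrightarrow> (tsum A * B) * 0"
      by (intro ennreal_tendsto_cmult w) (simp add: ennreal_mult_less_top A b)
    then show "(\<lambda>n. (tsum A * B) * tsum (w n)) \<longlonglongrightarrow> 0" by simp
  qed simp
  moreover have "(\<lambda>n. conv (conv A c) (?t n) i) \<longlonglongrightarrow> tsum (\<lambda>j :: int ^ 'n. 0)"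
    unfolding conv_def[of "conv A c"]
  proof (rule nn_integral_dominated_convergence[where w = "\<lambda>j. conv A c (i - j) * b j"])
    have "tsum (\<lambda>j. conv A c (i - j) * b j) \<le> tsum (conv A c) * B"
      using conv_le_bound[of b B "conv A c" i, OF b(1)] by (simp add: conv_def[of "conv A c" b])
    also have "\<dots> < \<infinity>" using A c b by (simp add: tsum_conv ennreal_mult_less_top)
    finally show "tsum (\<lambda>j. conv A c (i - j) * b j) < \<infinity>" .
    show "AE j in count_space UNIV. conv A c (i - j) * ?t n j \<le> conv A c (i - j) * b j" for n
      by (auto split: split_indicator)
    show "AE j in count_space UNIV. (\<lambda>n. conv A c (i - j) * ?t n j) \<longlonglongrightarrow> 0"
    proof (rule AE_I2, rule tendsto_eventually)
      fix j
      have "conv A c (i - j) * ?t n j = 0" if "nat (supn j) \<le> n" for n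
        using that by (auto split: split_indicator)
      then show "eventually (\<lambda>n. conv A c (i - j) * ?t n j = 0) sequentially"
        unfolding eventually_sequentially by blast
    qed
  qed auto
  ultimately show ?thesis
    unfolding eq by (auto intro: tendsto_add_zero)
qed

section \<open>The kernel of the inverse\<close>

text \<open>Here S is just a bounded operator with the cell bound W; that it inverts an operator
  enters in \<open>inverse_representation\<close> alone.\<close>

locale localized_inverse =
  fixes p :: ennreal and \<alpha> M :: real and K :: "(real ^ 'n) \<times> (real ^ 'n) \<Rightarrow> complex"
    and c W :: "int ^ 'n \<Rightarrow> ennreal" and S :: "(real ^ 'n \<Rightarrow> complex) \<Rightarrow> (real ^ 'n \<Rightarrow> complex)"
  assumes p: "1 \<le> p" and \<alpha>: "0 < \<alpha>" and M: "0 \<le> M"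
    and c: "tsum c < top"
    and near: "\<And>x y x' y'. (\<And>i. \<bar>((y - x) - (y' - x')) $ i\<bar> \<le> 2) \<Longrightarrow>
        ennreal (cmod (K (x, y))) \<le> c (fl x' - fl y')"
    and holder: "holder_dominated \<alpha> M K"
    and S: "bounded_operator_on_Lp p S"
    and W: "tsum W < top"
    and S_le: "\<And>g i. g \<in> Lp p \<Longrightarrow> cell_norm p (S g) i \<le> conv W (cell_norm p g) i"
begin

lemma K_dominated: "dominated K c"
  using near by (simp add: dominated_def)

lemma K_measurable: "K \<in> borel_measurable borel"
  by (intro borel_measurable_continuous_onI holder_dominated_continuous[OF holder \<alpha> M])

lemma S_Lp: "f \<in> Lp p \<Longrightarrow> S f \<in> Lp p"
  using S by (simp add: bounded_operator_on_Lp_def)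

lemma S_add: "f \<in> Lp p \<Longrightarrow> g \<in> Lp p \<Longrightarrow> AE x in lborel. S (\<lambda>t. f t + g t) x = S f x + S g x"
  using S by (simp add: bounded_operator_on_Lp_def)

lemma S_cmult: "f \<in> Lp p \<Longrightarrow> AE x in lborel. S (\<lambda>t. a * f t) x = a * S f x"
  using S by (simp add: bounded_operator_on_Lp_def)

text \<open>T S g at a single point. The outer integral removes the dependence on the representative
  of \<open>S g\<close>, so linearity in g holds exactly and not only almost everywhere.\<close>

definition pairing :: "real ^ 'n \<Rightarrow> (real ^ 'n \<Rightarrow> complex) \<Rightarrow> complex" where
  "pairing x g = integral_operator K (S g) x"

lemma pairing_le:
  assumes "g \<in> Lp p"
  shows "ennreal (cmod (pairing x g)) \<le> conv (conv c W) (cell_norm p g) (fl x)"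
proof -
  have "ennreal (cmod (pairing x g)) \<le> conv c (cell_norm p (S g)) (fl x)"
    unfolding pairing_def
    by (rule integral_operator_le[OF Lp_measurable[OF S_Lp[OF assms]] p K_dominated])
  also have "\<dots> \<le> conv c (conv W (cell_norm p g)) (fl x)"
    by (intro conv_mono S_le assms) simp
  finally show ?thesis by (simp add: conv_assoc)
qed

lemma K_integrable: "f \<in> Lp p \<Longrightarrow> integrable lborel (\<lambda>y. K (x, y) * f y)"
  by (rule kernel_integrable[OF kernel_section_measurable(1)[OF K_measurable] _ p _ c])
    (use K_dominated in \<open>auto simp: dominated_def\<close>)

lemma integral_operator_cong_AE:
  assumes "f \<in> borel_measurable borel" "g \<in> borel_measurable borel" "AE x in lborel. f x = g x"
  shows "integral_operator K f x = integral_operator K g x"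
  unfolding integral_operator_def
proof (rule integral_cong_AE)
  show "AE y in lborel. K (x, y) * f y = K (x, y) * g y"
    using assms(3) by eventually_elim simp
qed (use assms(1,2) kernel_section_measurable(1)[OF K_measurable, of x] in measurable)

lemma pairing_add:
  assumes f: "f \<in> Lp p" and g: "g \<in> Lp p"
  shows "pairing x (\<lambda>t. f t + g t) = pairing x f + pairing x g"
proof -
  have "pairing x (\<lambda>t. f t + g t) = integral_operator K (\<lambda>t. S f t + S g t) x"
    unfolding pairing_def
    using S_add[OF f g] Lp_measurable[OF S_Lp[OF f]] Lp_measurable[OF S_Lp[OF g]]
      Lp_measurable[OF S_Lp[OF Lp_add[OF p f g]]]
    by (intro integral_operator_cong_AE) auto
  also have "\<dots> = pairing x f + pairing x g"
    using K_integrable[OF S_Lp[OF f], of x] K_integrable[OF S_Lp[OF g], of x]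
    by (simp add: pairing_def integral_operator_def distrib_left)
  finally show ?thesis .
qed

lemma pairing_cmult:
  assumes f: "f \<in> Lp p"
  shows "pairing x (\<lambda>t. a * f t) = a * pairing x f"
proof -
  have "pairing x (\<lambda>t. a * f t) = integral_operator K (\<lambda>t. a * S f t) x"
    unfolding pairing_def
    using S_cmult[OF f, of a] Lp_measurable[OF S_Lp[OF f]] Lp_measurable[OF S_Lp[OF Lp_cmult[OF p f]]]
    by (intro integral_operator_cong_AE) auto
  also have "\<dots> = a * pairing x f"
    by (simp add: pairing_def integral_operator_def mult.left_commute)
  finally show ?thesis .
qed

lemma pairing_diff:
  assumes f: "f \<in> Lp p" and g: "g \<in> Lp p"
  shows "pairing x (\<lambda>t. f t - g t) = pairing x f - pairing x g"
  using pairing_add[OF f Lp_cmult[OF p g, of "- 1"]] pairing_cmult[OF g, of x "- 1"] by simp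

lemma Lp_zero: "(\<lambda>x :: real ^ 'n. 0) \<in> Lp p"
  by (auto simp: Lp_def intro!: le_less_trans[OF esssup_I[where c = 0]])

lemma pairing_sum:
  assumes "finite V" "\<And>v. v \<in> V \<Longrightarrow> u v \<in> Lp p"
  shows "(\<lambda>t. \<Sum>v\<in>V. a v * u v t) \<in> Lp p
    \<and> pairing x (\<lambda>t. \<Sum>v\<in>V. a v * u v t) = (\<Sum>v\<in>V. a v * pairing x (u v))"
  using assms
proof (induction V rule: finite_induct)
  case empty
  then show ?case using pairing_cmult[OF Lp_zero, of x 0] by (simp add: Lp_zero)
next
  case (insert v V)
  then show ?case
    using pairing_add[of "\<lambda>t. a v * u v t" "\<lambda>t. \<Sum>v\<in>V. a v * u v t" x]
    by (auto simp: pairing_cmult Lp_cmult Lp_add p)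
qed

section \<open>Columns of K and the kernel of T S T\<close>

definition column :: "real ^ 'n \<Rightarrow> real ^ 'n \<Rightarrow> complex" where
  "column y z = K (z, y)"

lemma column_measurable: "column y \<in> borel_measurable borel"
  unfolding column_def[abs_def] by (rule kernel_section_measurable(2)[OF K_measurable])

lemma cell_norm_column_le:
  assumes "\<And>i. \<bar>h $ i\<bar> \<le> 2"
  shows "cell_norm p (column (y + h)) i \<le> c (i - fl y)"
proof (rule cell_norm_le[OF column_measurable p])
  fix z assume z: "z \<in> cell i"
  have "ennreal (cmod (K (z, y + h))) \<le> c (fl z - fl y)"
    by (rule near) (use assms in simp)
  then show "ennreal (cmod (column (y + h) z)) \<le> c (i - fl y)"
    using z by (simp add: column_def cell_def)
qed

lemma column_Lp: "column y \<in> Lp p"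
proof -
  have "seq_norm p (cell_norm p (column y)) \<le> tsum (cell_norm p (column y))"
    by (rule seq_norm_le_tsum[OF p])
  also have "\<dots> \<le> tsum (\<lambda>i. c (i - fl y))"
    using cell_norm_column_le[of 0 y] by (intro nn_integral_mono) simp
  also have "\<dots> < top" using c by (simp add: tsum_shift)
  finally show ?thesis using p column_measurable by (simp add: Lp_iff)
qed

text \<open>
  The kernel of \<open>T S T\<close>. It is defined for every pair \<open>(x, y)\<close>, although \<open>S\<close> of a column of \<open>K\<close> is
  determined only almost everywhere.
\<close>

definition K2 :: "(real ^ 'n) \<times> (real ^ 'n) \<Rightarrow> complex" where
  "K2 = (\<lambda>(x, y). pairing x (column y))"

abbreviation c2 :: "int ^ 'n \<Rightarrow> ennreal" where
  "c2 \<equiv> conv (conv c W) c"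

lemma tsum_c2: "tsum c2 < top"
  using c W by (simp add: tsum_conv ennreal_mult_less_top)

lemma K2_dominated: "dominated K2 c2"
  unfolding dominated_def
proof (intro allI)
  fix x y
  have "ennreal (cmod (K2 (x, y))) \<le> conv (conv c W) (cell_norm p (column y)) (fl x)"
    unfolding K2_def by (simp add: pairing_le column_Lp)
  also have "\<dots> \<le> conv (conv c W) (\<lambda>i. c (i - fl y)) (fl x)"
    using cell_norm_column_le[of 0 y] by (intro conv_mono) auto
  finally show "ennreal (cmod (K2 (x, y))) \<le> c2 (fl x - fl y)"
    by (simp add: conv_shift)
qed

text \<open>The shift is made in two steps, in x with the column at y + hy kept, then in y. In each
  step \<open>w\<close> replaces one of the outer factors \<open>c\<close>, and S is left
  untouched.\<close>

lemma K2_modulus: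
  assumes \<delta>: "\<delta> < 1" and w: "\<And>x y. modulus_of_continuity \<delta> K (x, y) \<le> w (fl x - fl y)"
  shows "modulus_of_continuity \<delta> K2 (x, y) \<le> conv (conv w W) c (fl x - fl y) + conv (conv c W) w (fl x - fl y)"
  unfolding modulus_of_continuity_def
proof (rule SUP_least)
  fix h :: "(real ^ 'n) \<times> (real ^ 'n)" assume "h \<in> {h. norm h \<le> \<delta>}"
  then obtain hx hy where h: "h = (hx, hy)" "norm (hx, hy) \<le> \<delta>" by (cases h) auto
  have hx: "norm (hx, 0 :: real ^ 'n) \<le> \<delta>" and hy: "norm (0 :: real ^ 'n, hy) \<le> \<delta>"
    using h(2) norm_fst_le[of hx hy] norm_snd_le[of hy hx] by simp_all
  have hy2: "\<bar>hy $ i\<bar> \<le> 2" for i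
    using component_le_norm_cart[of hy i] hy \<delta> by simp
  let ?u = "column (y + hy)"
  have Su: "S ?u \<in> Lp p" by (intro S_Lp column_Lp)
  have 1: "ennreal (cmod (pairing (x + hx) ?u - pairing x ?u)) \<le> conv (conv w W) c (fl x - fl y)"
  proof -
    have "pairing (x + hx) ?u - pairing x ?u = (\<integral>z. (K (x + hx, z) - K (x, z)) * S ?u z \<partial>lborel)"
      using K_integrable[OF Su, of x] K_integrable[OF Su, of "x + hx"]
      by (simp add: pairing_def integral_operator_def left_diff_distrib)
    then have "ennreal (cmod (pairing (x + hx) ?u - pairing x ?u))
        \<le> (\<integral>\<^sup>+z. ennreal (cmod ((K (x + hx, z) - K (x, z)) * S ?u z)) \<partial>lborel)"
      by (simp only: norm_integral_le_nn)
    also have "\<dots> \<le> conv w (cell_norm p (S ?u)) (fl x)"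
    proof (rule nn_integral_kernel_le[OF Lp_measurable[OF Su] p])
      fix z
      show "ennreal (cmod (K (x + hx, z) - K (x, z))) \<le> w (fl x - fl z)"
        using modulus_ge[OF hx, of K "(x, z)"] w[of x z] by simp
    qed
    \<comment> \<open>The column sits at y + hy but is bounded at the cell of y; this is the use of
      the slack in \<open>near\<close>.\<close>
    also have "\<dots> \<le> conv w (conv W (\<lambda>i. c (i - fl y))) (fl x)"
      by (intro conv_mono order_refl order_trans[OF S_le[OF column_Lp]] cell_norm_column_le hy2)
    also have "\<dots> = conv (conv w W) c (fl x - fl y)"
      by (simp add: conv_assoc[symmetric] conv_shift)
    finally show ?thesis .
  qed
  have 2: "ennreal (cmod (pairing x ?u - pairing x (column y))) \<le> conv (conv c W) w (fl x - fl y)"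
  proof -
    let ?d = "\<lambda>z. ?u z - column y z"
    have d: "?d \<in> Lp p"
      using Lp_add[OF p column_Lp Lp_cmult[OF p column_Lp, of "- 1"]] by simp
    have "ennreal (cmod (pairing x ?u - pairing x (column y))) = ennreal (cmod (pairing x ?d))"
      by (simp add: pairing_diff column_Lp)
    also have "\<dots> \<le> conv (conv c W) (cell_norm p ?d) (fl x)" by (rule pairing_le[OF d])
    also have "\<dots> \<le> conv (conv c W) (\<lambda>i. w (i - fl y)) (fl x)"
    proof (intro conv_mono order_refl cell_norm_le[OF Lp_measurable[OF d] p])
      fix i and z :: "real ^ 'n" assume z: "z \<in> cell i"
      show "ennreal (cmod (?d z)) \<le> w (i - fl y)"
        using modulus_ge[OF hy, of K "(z, y)"] w[of z y] z by (simp add: column_def cell_def)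
    qed
    finally show ?thesis by (simp add: conv_shift)
  qed
  have "cmod (K2 ((x, y) + h) - K2 (x, y))
      \<le> cmod (pairing (x + hx) ?u - pairing x ?u) + cmod (pairing x ?u - pairing x (column y))"
    unfolding K2_def h(1)
    using norm_triangle_ineq[of "pairing (x + hx) ?u - pairing x ?u" "pairing x ?u - pairing x (column y)"]
    by simp
  then have "ennreal (cmod (K2 ((x, y) + h) - K2 (x, y)))
      \<le> ennreal (cmod (pairing (x + hx) ?u - pairing x ?u)) + ennreal (cmod (pairing x ?u - pairing x (column y)))"
    by (simp flip: ennreal_plus)
  also have "\<dots> \<le> conv (conv w W) c (fl x - fl y) + conv (conv c W) w (fl x - fl y)"
    by (intro add_mono 1 2)
  finally show "ennreal (cmod (K2 ((x, y) + h) - K2 (x, y)))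
      \<le> conv (conv w W) c (fl x - fl y) + conv (conv c W) w (fl x - fl y)" .
qed

abbreviation M2 :: real where
  "M2 \<equiv> 2 * enn2real (tsum W) * enn2real (tsum c) * M"

text \<open>The factor 2 in \<open>M2\<close> counts the two terms. It stands apart from
  \<open>K2_holder\<close> because the Riemann sums need it for the very sequences that
  \<open>K2_modulus\<close> produces.\<close>

lemma K2_holder_aux:
  assumes "tsum w \<le> ennreal (M * \<delta> powr \<alpha>)"
  shows "tsum (\<lambda>m. conv (conv w W) c m + conv (conv c W) w m) \<le> ennreal (M2 * \<delta> powr \<alpha>)"
proof -
  have "tsum (\<lambda>m. conv (conv w W) c m + conv (conv c W) w m) = 2 * tsum W * tsum c * tsum w"
    by (simp add: nn_integral_add tsum_conv mult_ac flip: mult_2)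
  also have "\<dots> \<le> 2 * tsum W * tsum c * ennreal (M * \<delta> powr \<alpha>)"
    by (intro mult_left_mono assms) simp
  also have "\<dots> = ennreal 2 * ennreal (enn2real (tsum W)) * ennreal (enn2real (tsum c)) * ennreal (M * \<delta> powr \<alpha>)"
    using c W by simp
  also have "\<dots> = ennreal (M2 * \<delta> powr \<alpha>)"
    using M by (simp only: ennreal_mult[symmetric] mult_nonneg_nonneg enn2real_nonneg powr_ge_zero
        zero_le_numeral mult.assoc)
  finally show ?thesis .
qed

lemma K2_holder: "holder_dominated \<alpha> M2 K2"
  unfolding holder_dominated_def
proof (intro allI impI)
  fix \<delta> :: real assume \<delta>: "0 < \<delta> \<and> \<delta> < 1"
  obtain w where w: "tsum w \<le> ennreal (M * \<delta> powr \<alpha>)"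
    "\<And>x y. modulus_of_continuity \<delta> K (x, y) \<le> w (fl x - fl y)"
    using holder \<delta> by (auto simp: holder_dominated_def)
  show "\<exists>w. tsum w \<le> ennreal (M2 * \<delta> powr \<alpha>) \<and> (\<forall>x y. modulus_of_continuity \<delta> K2 (x, y) \<le> w (fl x - fl y))"
    using K2_holder_aux[OF w(1)] K2_modulus[OF _ w(2)] \<delta> by blast
qed

lemma M2_nonneg: "0 \<le> M2"
  using M by simp

lemma K2_measurable: "K2 \<in> borel_measurable borel"
  by (intro borel_measurable_continuous_onI holder_dominated_continuous[OF K2_holder \<alpha> M2_nonneg])

text \<open>By linearity, \<open>pairing x\<close> maps a Riemann sum of T f to the Riemann sum of
  the integral operator with kernel \<open>K2\<close>. Both errors tend to 0, so two numbers
  independent of n agree.\<close>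

lemma pairing_integral_operator:
  assumes f: "f \<in> Lp p"
  shows "pairing x (integral_operator K f) = integral_operator K2 f x"
proof -
  let ?b = "cell_norm p f"
  let ?\<delta> = "\<lambda>n. real CARD('n) / real n"
  \<comment> \<open>The choice is meaningful once n exceeds the dimension, where
    \<open>?\<delta> n < 1\<close>; finitely many other n do not affect the limit.\<close>
  define w where "w n = (SOME w. tsum w \<le> ennreal (M * ?\<delta> n powr \<alpha>) \<and>
      (\<forall>x y. modulus_of_continuity (?\<delta> n) K (x, y) \<le> w (fl x - fl y)))" for n
  define w2 where "w2 n m = conv (conv (w n) W) c m + conv (conv c W) (w n) m" for n m
  have w: "tsum (w n) \<le> ennreal (M * ?\<delta> n powr \<alpha>)"
    "\<And>x y. modulus_of_continuity (?\<delta> n) K (x, y) \<le> w n (fl x - fl y)" if n: "CARD('n) < n" for n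
  proof -
    have "0 < ?\<delta> n" "?\<delta> n < 1" using n by simp_all
    then have "\<exists>w. tsum w \<le> ennreal (M * ?\<delta> n powr \<alpha>) \<and>
      (\<forall>x y. modulus_of_continuity (?\<delta> n) K (x, y) \<le> w (fl x - fl y))"
      using holder by (simp add: holder_dominated_def)
    from someI_ex[OF this] show "tsum (w n) \<le> ennreal (M * ?\<delta> n powr \<alpha>)"
      "\<And>x y. modulus_of_continuity (?\<delta> n) K (x, y) \<le> w n (fl x - fl y)"
      by (auto simp: w_def)
  qed
  \<comment> \<open>Convolution with \<open>indicator {0}\<close> is the identity; it gives both
    errors the form treated by \<open>riemann_error_tendsto_0\<close>.\<close>
  define err where "err n = conv (conv c W) (riemann_error (w n) c n ?b) (fl x)
      + conv (indicator {0}) (riemann_error (w2 n) c2 n ?b) (fl x)" for n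
  have le: "ennreal (cmod (pairing x (integral_operator K f) - integral_operator K2 f x)) \<le> err n"
    if n: "CARD('n) < n" for n
  proof -
    have n0: "0 < n" using n by simp
    let ?s = "\<lambda>t. \<Sum>v\<in>grid_points n. grid_coeff n f v * column v t"
    let ?g = "\<lambda>t. integral_operator K f t - ?s t"
    have s: "?s \<in> Lp p" "pairing x ?s = (\<Sum>v\<in>grid_points n. grid_coeff n f v * pairing x (column v))"
      using pairing_sum[OF finite_grid_points column_Lp, where a = "grid_coeff n f" and x = x] by auto
    have Tf: "integral_operator K f \<in> Lp p"
      by (rule integral_operator_Lp[OF p f K_dominated K_measurable c])
    have g: "?g \<in> Lp p"
      using Lp_add[OF p Tf Lp_cmult[OF p s(1), of "- 1"]] by simp
    have "cell_norm p ?g i \<le> riemann_error (w n) c n ?b i" for i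
    proof (rule cell_norm_le[OF Lp_measurable[OF g] p])
      fix z assume z: "z \<in> cell i"
      then show "ennreal (cmod (?g z)) \<le> riemann_error (w n) c n ?b i"
        using riemann_sum_error[OF p f K_dominated c K_measurable n0 order_refl w(2)[OF n], of z]
        by (simp add: column_def cell_def)
    qed
    then have "conv (conv c W) (cell_norm p ?g) (fl x) \<le> conv (conv c W) (riemann_error (w n) c n ?b) (fl x)"
      by (intro conv_mono) auto
    then have 1: "ennreal (cmod (pairing x ?g)) \<le> conv (conv c W) (riemann_error (w n) c n ?b) (fl x)"
      using pairing_le[OF g, of x] by (rule order_trans[rotated])
    have 2: "ennreal (cmod (integral_operator K2 f x - pairing x ?s)) \<le> riemann_error (w2 n) c2 n ?b (fl x)"
    proof -
      have "?\<delta> n < 1" using n by simp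
      from riemann_sum_error[OF p f K2_dominated tsum_c2 K2_measurable n0 order_refl, of "w2 n" x]
        K2_modulus[OF this w(2)[OF n]]
      show ?thesis by (simp add: s(2) w2_def K2_def)
    qed
    have "pairing x ?g = pairing x (integral_operator K f) - pairing x ?s"
      by (rule pairing_diff[OF Tf s(1)])
    then have "cmod (pairing x (integral_operator K f) - integral_operator K2 f x)
        \<le> cmod (pairing x ?g) + cmod (integral_operator K2 f x - pairing x ?s)"
      using norm_triangle_ineq4[of "pairing x ?g" "integral_operator K2 f x - pairing x ?s"]
      by (simp add: algebra_simps)
    then have "ennreal (cmod (pairing x (integral_operator K f) - integral_operator K2 f x))
        \<le> ennreal (cmod (pairing x ?g)) + ennreal (cmod (integral_operator K2 f x - pairing x ?s))"
      by (simp flip: ennreal_plus)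
    also have "\<dots> \<le> err n"
      unfolding err_def conv_indicator_0 by (intro add_mono 1 2)
    finally show ?thesis .
  qed
  have ev: "eventually (\<lambda>n. CARD('n) < n) sequentially" by (rule eventually_gt_at_top)
  have lim: "(\<lambda>n. ennreal (m * ?\<delta> n powr \<alpha>)) \<longlonglongrightarrow> 0" for m
  proof -
    have "(\<lambda>n. m * ?\<delta> n powr \<alpha>) \<longlonglongrightarrow> m * 0"
      by (intro tendsto_mult tendsto_const) (use \<alpha> in real_asymp)
    then have "(\<lambda>n. ennreal (m * ?\<delta> n powr \<alpha>)) \<longlonglongrightarrow> ennreal (m * 0)"
      by (rule tendsto_ennrealI)
    then show ?thesis by simp
  qed
  have w_lim: "(\<lambda>n. tsum (w n)) \<longlonglongrightarrow> 0"
    by (rule tendsto_sandwich[OF _ eventually_mono[OF ev w(1)] tendsto_const lim]) simp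
  have w2_lim: "(\<lambda>n. tsum (w2 n)) \<longlonglongrightarrow> 0"
    unfolding w2_def[abs_def]
    by (rule tendsto_sandwich[OF _ eventually_mono[OF ev K2_holder_aux[OF w(1)]] tendsto_const lim]) simp
  have b: "?b j \<le> seq_norm p ?b" "seq_norm p ?b < top" for j
    using f p by (simp_all add: Lp_iff le_seq_norm)
  have "err \<longlonglongrightarrow> 0 + 0"
    unfolding err_def[abs_def]
    by (intro tendsto_add riemann_error_tendsto_0[where B = "seq_norm p ?b"] b w_lim w2_lim c tsum_c2)
      (use c W in \<open>simp_all add: tsum_conv ennreal_mult_less_top\<close>)
  moreover have "eventually (\<lambda>n. ennreal (cmod (pairing x (integral_operator K f) - integral_operator K2 f x)) \<le> err n) sequentially"
    using ev by eventually_elim (rule le)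
  ultimately have "ennreal (cmod (pairing x (integral_operator K f) - integral_operator K2 f x)) \<le> 0 + 0"
    by (intro tendsto_lowerbound) auto
  then show ?thesis by simp
qed

text \<open>S T f and T S f both equal f - lam S f almost everywhere, so T S T f - T f = - lam T S f
  = lam^2 S f - lam f. Dividing by lam^2 gives the kernel.\<close>

lemma inverse_representation:
  assumes lam: "lam \<noteq> 0"
    and inv: "\<And>f. f \<in> Lp p \<Longrightarrow> AE x in lborel. S (\<lambda>x. lam * f x + integral_operator K f x) x = f x"
      "\<And>f. f \<in> Lp p \<Longrightarrow> AE x in lborel. lam * S f x + integral_operator K (S f) x = f x"
    and f: "f \<in> Lp p"
  shows "AE x in lborel. S f x = inverse lam * f x
     + integral_operator (\<lambda>z. inverse (lam\<^sup>2) * (K2 z - K z)) f x"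
proof -
  let ?T = "integral_operator K"
  have Tf: "?T f \<in> Lp p"
    by (rule integral_operator_Lp[OF p f K_dominated K_measurable c])
  have STf: "AE x in lborel. S (?T f) x = f x - lam * S f x"
    using inv(1)[OF f] S_add[OF Lp_cmult[OF p f] Tf, of lam] S_cmult[OF f, of lam]
    by eventually_elim (simp add: algebra_simps)
  \<comment> \<open>This holds at every x, although S T f is known only almost everywhere, because
    the outer T integrates over it.\<close>
  have K2: "integral_operator K2 f x = ?T f x - lam * ?T (S f) x" for x
  proof -
    have "integral_operator K2 f x = ?T (S (?T f)) x"
      using pairing_integral_operator[OF f] by (simp add: pairing_def)
    also have "\<dots> = ?T (\<lambda>t. f t - lam * S f t) x"
      using STf Lp_measurable[OF S_Lp[OF Tf]] Lp_measurable[OF f] Lp_measurable[OF S_Lp[OF f]]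
      by (intro integral_operator_cong_AE) auto
    also have "\<dots> = (\<integral>y. K (x, y) * f y - lam * (K (x, y) * S f y) \<partial>lborel)"
      unfolding integral_operator_def by (simp add: algebra_simps)
    also have "\<dots> = ?T f x - lam * ?T (S f) x"
      using K_integrable[OF f, of x] K_integrable[OF S_Lp[OF f], of x]
      by (simp add: integral_operator_def)
    finally show ?thesis .
  qed
  have K2int: "integrable lborel (\<lambda>y. K2 (x, y) * f y)" for x
    by (rule kernel_integrable[OF kernel_section_measurable(1)[OF K2_measurable] _ p f tsum_c2])
      (use K2_dominated in \<open>auto simp: dominated_def\<close>)
  have K': "integral_operator (\<lambda>z. inverse (lam\<^sup>2) * (K2 z - K z)) f x
      = inverse (lam\<^sup>2) * (integral_operator K2 f x - ?T f x)" for x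
  proof -
    have "integral_operator (\<lambda>z. inverse (lam\<^sup>2) * (K2 z - K z)) f x
        = (\<integral>y. inverse (lam\<^sup>2) * (K2 (x, y) * f y - K (x, y) * f y) \<partial>lborel)"
      unfolding integral_operator_def by (simp add: algebra_simps)
    also have "\<dots> = inverse (lam\<^sup>2) * (integral_operator K2 f x - ?T f x)"
      using K2int[of x] K_integrable[OF f, of x] by (simp add: integral_operator_def)
    finally show ?thesis .
  qed
  show ?thesis
    using inv(2)[OF f]
  proof eventually_elim
    case (elim x)
    have TSf: "?T (S f) x = f x - lam * S f x" using elim by (simp add: algebra_simps)
    show ?case
      unfolding K' K2 TSf using lam by (simp add: power2_eq_square field_simps)
  qed
qed

lemma inverse_kernel_bounds:
  obtains D where "0 < D" "amalgam_kernel_bounds \<alpha> D (\<lambda>z. a * (K2 z - K z))"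
proof (rule dominated_imp_amalgam)
  let ?a = "ennreal (cmod a)"
  let ?K' = "\<lambda>z. a * (K2 z - K z)"
  \<comment> \<open>One estimate for both bounds: s and t are values of \<open>K2\<close> and K for
    the size, and increments of them for the modulus.\<close>
  have scale: "ennreal (cmod (a * (s - t))) \<le> ?a * (A + B)"
    if "ennreal (cmod s) \<le> A" "ennreal (cmod t) \<le> B" for s t A B
  proof -
    have "ennreal (cmod (a * (s - t))) = ?a * ennreal (cmod (s - t))"
      by (simp add: norm_mult ennreal_mult)
    also have "\<dots> \<le> ?a * (ennreal (cmod s) + ennreal (cmod t))"
      by (intro mult_left_mono) (simp_all add: norm_triangle_ineq4 flip: ennreal_plus)
    also have "\<dots> \<le> ?a * (A + B)" by (intro mult_left_mono add_mono that) simp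
    finally show ?thesis .
  qed
  show "dominated ?K' (\<lambda>m. ?a * (c2 m + c m))"
    using K2_dominated K_dominated by (auto simp: dominated_def intro!: scale)
  show "tsum (\<lambda>m. ?a * (c2 m + c m)) < top"
    using tsum_c2 c by (simp add: nn_integral_cmult nn_integral_add ennreal_mult_less_top)
  show "0 \<le> cmod a * (M2 + M)" using M by simp
  show "holder_dominated \<alpha> (cmod a * (M2 + M)) ?K'"
    unfolding holder_dominated_def
  proof (intro allI impI)
    fix \<delta> :: real assume \<delta>: "0 < \<delta> \<and> \<delta> < 1"
    obtain w where w: "tsum w \<le> ennreal (M * \<delta> powr \<alpha>)"
      "\<And>x y. modulus_of_continuity \<delta> K (x, y) \<le> w (fl x - fl y)"
      using holder \<delta> by (auto simp: holder_dominated_def)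
    obtain w2 where w2: "tsum w2 \<le> ennreal (M2 * \<delta> powr \<alpha>)"
      "\<And>x y. modulus_of_continuity \<delta> K2 (x, y) \<le> w2 (fl x - fl y)"
      using K2_holder \<delta> by (auto simp: holder_dominated_def)
    have "tsum (\<lambda>m. ?a * (w2 m + w m)) \<le> ?a * (ennreal (M2 * \<delta> powr \<alpha>) + ennreal (M * \<delta> powr \<alpha>))"
      by (simp add: nn_integral_cmult nn_integral_add) (intro mult_left_mono add_mono w w2, simp)
    also have "\<dots> = ennreal (cmod a * (M2 + M) * \<delta> powr \<alpha>)"
      using M by (subst ennreal_plus[symmetric]) (simp_all add: ennreal_mult[symmetric] algebra_simps)
    finally have "tsum (\<lambda>m. ?a * (w2 m + w m)) \<le> ennreal (cmod a * (M2 + M) * \<delta> powr \<alpha>)" .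
    moreover have "modulus_of_continuity \<delta> ?K' (x, y) \<le> ?a * (w2 (fl x - fl y) + w (fl x - fl y))" for x y
      unfolding modulus_of_continuity_def
    proof (rule SUP_least)
      fix h :: "(real ^ 'n) \<times> (real ^ 'n)" assume h: "h \<in> {h. norm h \<le> \<delta>}"
      have "?K' ((x, y) + h) - ?K' (x, y) = a * ((K2 ((x, y) + h) - K2 (x, y)) - (K ((x, y) + h) - K (x, y)))"
        by (simp add: algebra_simps)
      also have "ennreal (cmod \<dots>) \<le> ?a * (w2 (fl x - fl y) + w (fl x - fl y))"
        using h by (intro scale order_trans[OF modulus_ge w(2)] order_trans[OF modulus_ge w2(2)]) auto
      finally show "ennreal (cmod (?K' ((x, y) + h) - ?K' (x, y))) \<le> ?a * (w2 (fl x - fl y) + w (fl x - fl y))" .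
    qed
    ultimately show "\<exists>w. tsum w \<le> ennreal (cmod a * (M2 + M) * \<delta> powr \<alpha>)
        \<and> (\<forall>x y. modulus_of_continuity \<delta> ?K' (x, y) \<le> w (fl x - fl y))"
      by (intro exI[of _ "\<lambda>m. ?a * (w2 m + w m)"]) auto
  qed
qed (rule that)

end

theorem corollary4p2:
  fixes p :: ennreal and lam :: complex and \<alpha> D :: real
    and K :: "(real ^ 'n) \<times> (real ^ 'n) \<Rightarrow> complex"
    and S :: "(real ^ 'n \<Rightarrow> complex) \<Rightarrow> (real ^ 'n \<Rightarrow> complex)"
  assumes "1 \<le> p" and "lam \<noteq> 0" and "0 < \<alpha>" and "\<alpha> \<le> 1"
    and "0 < D" and "amalgam_kernel_bounds \<alpha> D K"
    and "bounded_inverse_on_Lp p (\<lambda>f x. lam * f x + integral_operator K f x) S"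
  shows "\<exists>K'. (\<exists>D'>0. amalgam_kernel_bounds \<alpha> D' K') \<and>
           (\<forall>f\<in>Lp p. AE x in lborel. S f x = inverse lam * f x + integral_operator K' f x)"
proof -
  obtain c where c: "tsum c < top"
    "\<And>x y x' y'. (\<And>i. \<bar>((y - x) - (y' - x')) $ i\<bar> \<le> 2) \<Longrightarrow> ennreal (cmod (K (x, y))) \<le> c (fl x' - fl y')"
    "holder_dominated \<alpha> (7 ^ CARD('n) * D) K"
    using amalgam_imp_dominated[OF assms(6,5)] by blast
  have M: "0 \<le> 7 ^ CARD('n) * D" using assms(5) by simp
  have K: "dominated K c" "K \<in> borel_measurable borel"
    using c(2) holder_dominated_continuous[OF c(3) assms(3) M]
    by (auto simp: dominated_def intro: borel_measurable_continuous_onI)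
  obtain W where W: "tsum W < top" "\<And>g i. g \<in> Lp p \<Longrightarrow> cell_norm p (S g) i \<le> conv W (cell_norm p g) i"
    using inverse_cell_norm_le[OF assms(1) K c(1) assms(7)] by blast
  interpret localized_inverse p \<alpha> "7 ^ CARD('n) * D" K c W S
    using assms c W M by unfold_locales (auto simp: bounded_inverse_on_Lp_def)
  obtain D' where D': "0 < D'" "amalgam_kernel_bounds \<alpha> D' (\<lambda>z. inverse (lam\<^sup>2) * (K2 z - K z))"
    using inverse_kernel_bounds[of "inverse (lam\<^sup>2)"] by blast
  show ?thesis
  proof (intro exI[of _ "\<lambda>z. inverse (lam\<^sup>2) * (K2 z - K z)"] conjI ballI)
    show "\<exists>D'>0. amalgam_kernel_bounds \<alpha> D' (\<lambda>z. inverse (lam\<^sup>2) * (K2 z - K z))"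
      using D' by blast
    show "AE x in lborel. S f x = inverse lam * f x
        + integral_operator (\<lambda>z. inverse (lam\<^sup>2) * (K2 z - K z)) f x" if "f \<in> Lp p" for f
      using assms(7) by (intro inverse_representation assms(2) that) (auto simp: bounded_inverse_on_Lp_def)
  qed
qed

end
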